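(* Let $d\in\mathbb{N}$, $1\le i\le l$, and let $u\in C^1(\widetilde\Omega_i)$ and $v\in C^0(\widetilde\Omega_i)$ be the classical solution of the wave problem, where $\widetilde\Omega_i=D\times[0,t_i]$, $\widetilde\Omega_{*i}=\partial D\times[0,t_i]$. Let $(u_{\theta_j},v_{\theta_j})$, $1\le j\le i$, be HLConcPINN approximations with parameters $\theta_j$, and $\hat u_i=u_{\theta_i}-u$, $\hat v_i=v_{\theta_i}-v$. Then $$\int_D\big(|\hat u_i(x,\tau)|^2+|\nabla\hat u_i(x,\tau)|^2+|\hat v_i(x,\tau)|^2\big)dx\le C_{G_i}\exp(2\Delta t)\quad\text{for }\tau\in[t_{i-1},t_i],$$ $$\int_{t_{i-1}}^{t_i}\int_D\big(|\hat u_i(x,t)|^2+|\nabla\hat u_i(x,t)|^2+|\hat v_i(x,t)|^2\big)dx\,dt\le C_{G_i}\,\Delta t\,\exp(2\Delta t),$$ where $C_{G_0}=0$, $C_{G_i}=\widetilde C_{G_i}+2C_{G_{i-1}}\exp(2\Delta t)$, $$\widetilde C_{G_i}=\int_{\Omega_i}\big(|R_{int1_i}|^2+|R_{int2_i}|^2+|\nabla R_{int1_i}|^2\big)dx\,dt$$ $$+2\sum_{j=1}^i\int_D\big(|R_{tb1_i}(x,t_{j-1})|^2+|R_{tb2_i}(x,t_{j-1})|^2+|\nabla R_{tb1_i}(x,t_{j-1})|^2\big)dx$$ $$+2|\Delta t|^{\frac12}C_{\partial D_{1i}}\Big(\int_{\Omega_{*i}}|R_{sb1_i}|^2ds(x)\,dt\Big)^{\frac12}+2|\Delta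 t|^{\frac12}C_{\partial D_{2i}}\Big(\int_{\Omega_{*i}}|R_{sb2_i}|^2ds(x)\,dt\Big)^{\frac12},$$ $C_{\partial D_{1i}}=|\partial D|^{\frac12}(\|u\|_{C^1(\widetilde\Omega_{*i})}+\|u_{\theta_i}\|_{C^1(\widetilde\Omega_{*i})})$ and $C_{\partial D_{2i}}=|\partial D|^{\frac12}(\|v\|_{C(\widetilde\Omega_{*i})}+\|v_{\theta_i}\|_{C(\widetilde\Omega_{*i})})$.
   Context: Wave problem. $D=[0,1)^d$ is the torus, $T>0$, and $(u,v)$ solves $\partial_tu-v=0$ and $\partial_tv-\Delta u=f$ in $D\times[0,T]$, $u(x,0)=\psi_1(x)$, $v(x,0)=\psi_2(x)$ in $D$, with periodic boundary conditions $u(x,t)=u(x+1,t)$ and $\nabla u(x,t)=\nabla u(x+1,t)$ on $\partial D\times[0,T]$. Here $\partial D$ is the boundary of the unit cube, and for $x$ on a face of the cube $x+1$ denotes the corresponding point on the opposite face. $\nabla,\Delta$ act in the space variable. Time blocks. For an integer $l\ge1$ put $\Delta t=T/l$, $t_i=i\Delta t$ ($0\le i\le l$), $\Omega_i=D\times[t_{i-1},t_i]$, $\Omega_{*i}=\partial D\times[t_{i-1},t_i]$. HLConcPINN (hidden-layer concatenated neural network). With $L\ge 3$, input dimension $l_0$, output dimension $l_L$ and hidden widths $l_1,\dots,l_{L-1}$, it is a map $z\in\mathbb{R}^{l_0}\mapsto\sum_{m=1}^{L-1}M_m h_m(z)+b_L$, where $h_0(z)=z$ and $h_m(z)=\sigma_m(W_m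 h_{m-1}(z)+b_m)$, with $W_m\in\mathbb{R}^{l_m\times l_{m-1}}$, $b_m\in\mathbb{R}^{l_m}$, $M_m\in\mathbb{R}^{l_L\times l_m}$, $b_L\in\mathbb{R}^{l_L}$; activations act componentwise, $\sigma_1=\sigma_2=\tanh$, and $\sigma_m$ for $m\ge3$ are smooth activation functions. $\theta$ denotes the collection of all parameters. Here $l_0=d+1$ (input $(x,t)$), and $u_{\theta_i},v_{\theta_i}$ are real-valued and considered on $D\times[0,t_i]$. Residuals. $R_{int1_i}=\partial_tu_{\theta_i}-v_{\theta_i}$; $R_{int2_i}=\partial_tv_{\theta_i}-\Delta u_{\theta_i}-f$; $R_{tb1_i}(x,t_{j-1})=u_{\theta_i}(x,t_{j-1})-u_{\theta_{j-1}}(x,t_{j-1})$ and $R_{tb2_i}(x,t_{j-1})=v_{\theta_i}(x,t_{j-1})-v_{\theta_{j-1}}(x,t_{j-1})$ for $1\le j\le i$, with $u_{\theta_0}(x,t_0)=\psi_1(x)$, $v_{\theta_0}(x,t_0)=\psi_2(x)$; on $\partial D$: $R_{sb1_i}(x,t)=v_{\theta_i}(x,t)-v_{\theta_i}(x+1,t)$, $R_{sb2_i}(x,t)=\nabla u_{\theta_i}(x,t)-\nabla u_{\theta_i}(x+1,t)$. $|\partial D|$ is the surface measure of $\partial D$; $\|w\|_{C(S)}$ is the sup norm and $\|w\|_{C^1(S)}$ the usual $C^1$ norm on $S$ (sum of sup norms of $w$ and its first-order partial derivatives). *)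

theory Defs
  imports "HOL-Analysis.Analysis"
begin

section \<open>The unit cell and its boundary\<close>

definition cell :: "(real ^ 'd) set" where
  "cell = {x. \<forall>k. 0 \<le> x $ k \<and> x $ k < 1}"

abbreviation closed_cell :: "(real ^ 'd) set" where
  "closed_cell \<equiv> closure cell"

abbreviation cell_boundary :: "(real ^ 'd) set" where
  "cell_boundary \<equiv> frontier cell"

definition set_coord :: "'d \<Rightarrow> real \<Rightarrow> real ^ 'd \<Rightarrow> real ^ 'd" where
  "set_coord k r x = (\<chi> j. if j = k then r else x $ j)"

text \<open>
  The point written x + 1 in the periodic boundary conditions: for x on one of the two faces
  orthogonal to direction k, the corresponding point on the opposite face. It depends on k,
  because on edges and corners x belongs to faces of several directions.
\<close>
definition opposite :: "'d \<Rightarrow> real ^ 'd \<Rightarrow> real ^ 'd" where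
  "opposite k x = set_coord k (1 - x $ k) x"

text \<open>
  The boundary of the cube is the union of the faces where coordinate k equals a, with a = 0 or
  a = 1, which overlap only in null sets. The integral over such a face is taken with respect to
  (d-1)-dimensional Lebesgue measure in the coordinates other than k. The integrand receives k as
  an additional argument, so that it can refer to the opposite face.
\<close>
definition face_integral :: "'d \<Rightarrow> real \<Rightarrow> (real ^ 'd \<Rightarrow> real) \<Rightarrow> real" where
  "face_integral k a g =
     (LINT y | (\<Pi>\<^sub>M j \<in> UNIV - {k}. restrict_space lborel {0..1}).
        g (\<chi> j. if j = k then a else y j))"

definition surface_integral :: "('d \<Rightarrow> real ^ 'd \<Rightarrow> real) \<Rightarrow> real" where
  "surface_integral g = (\<Sum>k\<in>UNIV. face_integral k 0 (g k) + face_integral k 1 (g k))"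

definition surface_area :: "'d::finite itself \<Rightarrow> real" where
  "surface_area _ = surface_integral (\<lambda>(_ :: 'd) (_ :: real ^ 'd). 1)"


section \<open>Derivatives on the closed cell and on a time interval\<close>

text \<open>
  Functions are only considered on the closed cell and on a time interval [0, s]; derivatives are
  one-sided at the ends of these domains.
\<close>
definition partial_x :: "'d \<Rightarrow> (real ^ 'd \<Rightarrow> real) \<Rightarrow> real ^ 'd \<Rightarrow> real" where
  "partial_x k g x =
     vector_derivative (\<lambda>r. g (set_coord k r x)) (at (x $ k) within {0..1})"

definition differentiable_x :: "'d \<Rightarrow> (real ^ 'd \<Rightarrow> real) \<Rightarrow> real ^ 'd \<Rightarrow> bool" where
  "differentiable_x k g x \<longleftrightarrow>
     (\<lambda>r. g (set_coord k r x)) differentiable (at (x $ k) within {0..1})"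

definition grad :: "(real ^ 'd \<Rightarrow> real) \<Rightarrow> real ^ 'd \<Rightarrow> real ^ 'd" where
  "grad g x = (\<chi> k. partial_x k g x)"

definition laplacian :: "(real ^ 'd \<Rightarrow> real) \<Rightarrow> real ^ 'd \<Rightarrow> real" where
  "laplacian g x = (\<Sum>k\<in>UNIV. partial_x k (partial_x k g) x)"

definition partial_t :: "real \<Rightarrow> (real ^ 'd \<Rightarrow> real \<Rightarrow> real) \<Rightarrow> real ^ 'd \<Rightarrow> real \<Rightarrow> real" where
  "partial_t s w x t = vector_derivative (w x) (at t within {0..s})"

definition differentiable_t :: "real \<Rightarrow> (real ^ 'd \<Rightarrow> real \<Rightarrow> real) \<Rightarrow> real ^ 'd \<Rightarrow> real \<Rightarrow> bool" where
  "differentiable_t s w x t \<longleftrightarrow> w x differentiable (at t within {0..s})"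

definition C0_upto :: "real \<Rightarrow> (real ^ 'd \<Rightarrow> real \<Rightarrow> real) \<Rightarrow> bool" where
  "C0_upto s w \<longleftrightarrow> continuous_on (closed_cell \<times> {0..s}) (\<lambda>(x, t). w x t)"

definition C1_upto :: "real \<Rightarrow> (real ^ 'd \<Rightarrow> real \<Rightarrow> real) \<Rightarrow> bool" where
  "C1_upto s w \<longleftrightarrow>
     C0_upto s w \<and>
     (\<forall>x\<in>closed_cell. \<forall>t\<in>{0..s}.
        differentiable_t s w x t \<and> (\<forall>k. differentiable_x k (\<lambda>y. w y t) x)) \<and>
     C0_upto s (partial_t s w) \<and>
     (\<forall>k. C0_upto s (\<lambda>x t. partial_x k (\<lambda>y. w y t) x))"

text \<open>The norms of C(S) and of C^1(S) for S = \<open>cell_boundary\<close> \<open>\<times>\<close> [0, s].\<close>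

definition sup_norm_bdry :: "real \<Rightarrow> (real ^ 'd \<Rightarrow> real \<Rightarrow> real) \<Rightarrow> real" where
  "sup_norm_bdry s w = (SUP (x, t) \<in> cell_boundary \<times> {0..s}. \<bar>w x t\<bar>)"

definition C1_norm_bdry :: "real \<Rightarrow> (real ^ 'd \<Rightarrow> real \<Rightarrow> real) \<Rightarrow> real" where
  "C1_norm_bdry s w =
     sup_norm_bdry s w + sup_norm_bdry s (partial_t s w)
     + (\<Sum>k\<in>UNIV. sup_norm_bdry s (\<lambda>x t. partial_x k (\<lambda>y. w y t) x))"


section \<open>The wave problem\<close>

text \<open>
  Classical means that the derivatives occurring in the two equations exist on the closed cell up
  to the initial and final time, and are continuous there.
\<close>
definition classical_wave_solution ::
  "real \<Rightarrow> (real ^ 'd \<Rightarrow> real \<Rightarrow> real) \<Rightarrow> (real ^ 'd \<Rightarrow> real) \<Rightarrow> (real ^ 'd \<Rightarrow> real)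
   \<Rightarrow> (real ^ 'd \<Rightarrow> real \<Rightarrow> real) \<Rightarrow> (real ^ 'd \<Rightarrow> real \<Rightarrow> real) \<Rightarrow> bool" where
  "classical_wave_solution T f \<psi>1 \<psi>2 u v \<longleftrightarrow>
     (\<forall>x\<in>closed_cell. \<forall>t\<in>{0..T}.
        differentiable_t T u x t \<and> differentiable_t T v x t \<and>
        (\<forall>k. differentiable_x k (\<lambda>y. u y t) x \<and>
             differentiable_x k (partial_x k (\<lambda>y. u y t)) x)) \<and>
     C0_upto T (partial_t T u) \<and> C0_upto T (partial_t T v) \<and>
     (\<forall>k. C0_upto T (\<lambda>x t. partial_x k (partial_x k (\<lambda>y. u y t)) x)) \<and>
     (\<forall>x\<in>cell. \<forall>t\<in>{0..T}. partial_t T u x t - v x t = 0) \<and>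
     (\<forall>x\<in>cell. \<forall>t\<in>{0..T}. partial_t T v x t - laplacian (\<lambda>y. u y t) x = f x t) \<and>
     (\<forall>x\<in>cell. u x 0 = \<psi>1 x \<and> v x 0 = \<psi>2 x) \<and>
     (\<forall>k. \<forall>x\<in>cell_boundary. \<forall>t\<in>{0..T}. x $ k \<in> {0, 1} \<longrightarrow>
        u x t = u (opposite k x) t \<and>
        grad (\<lambda>y. u y t) x = grad (\<lambda>y. u y t) (opposite k x))"


section \<open>Hidden-layer concatenated neural networks\<close>

text \<open>
  Vectors and matrices are indexed from 0. The field \<open>out_weight\<close> m is the matrix multiplying the
  output of hidden layer m, and \<open>out_bias\<close> is the bias of the output layer. Entries outside the
  dimensions prescribed by \<open>width\<close> are irrelevant.
\<close>
record hlconc_net =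
  depth :: nat
  width :: "nat \<Rightarrow> nat"
  act :: "nat \<Rightarrow> real \<Rightarrow> real"
  weight :: "nat \<Rightarrow> nat \<Rightarrow> nat \<Rightarrow> real"
  bias :: "nat \<Rightarrow> nat \<Rightarrow> real"
  out_weight :: "nat \<Rightarrow> nat \<Rightarrow> nat \<Rightarrow> real"
  out_bias :: "nat \<Rightarrow> real"

primrec hidden_layer :: "hlconc_net \<Rightarrow> (nat \<Rightarrow> real) \<Rightarrow> nat \<Rightarrow> nat \<Rightarrow> real" where
  "hidden_layer \<theta> z 0 = z"
| "hidden_layer \<theta> z (Suc m) = (\<lambda>r.
     act \<theta> (Suc m)
       ((\<Sum>c<width \<theta> m. weight \<theta> (Suc m) r c * hidden_layer \<theta> z m c) + bias \<theta> (Suc m) r))"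

definition net_output :: "hlconc_net \<Rightarrow> (nat \<Rightarrow> real) \<Rightarrow> nat \<Rightarrow> real" where
  "net_output \<theta> z r =
     (\<Sum>m = 1..depth \<theta> - 1. \<Sum>c<width \<theta> m. out_weight \<theta> m r c * hidden_layer \<theta> z m c)
     + out_bias \<theta> r"

definition smooth_function :: "(real \<Rightarrow> real) \<Rightarrow> bool" where
  "smooth_function g \<longleftrightarrow> (\<forall>n x. (deriv ^^ n) g field_differentiable (at x))"

definition hlconc_pinn :: "nat \<Rightarrow> nat \<Rightarrow> hlconc_net \<Rightarrow> bool" where
  "hlconc_pinn n_in n_out \<theta> \<longleftrightarrow>
     3 \<le> depth \<theta> \<and> width \<theta> 0 = n_in \<and> width \<theta> (depth \<theta>) = n_out \<and>
     (\<forall>m\<in>{1..<depth \<theta>}. 1 \<le> width \<theta> m) \<and>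
     act \<theta> 1 = tanh \<and> act \<theta> 2 = tanh \<and>
     (\<forall>m\<in>{3..<depth \<theta>}. smooth_function (act \<theta> m))"

text \<open>
  The input (x, t) as a vector with d + 1 entries: the coordinates of x in an arbitrary but fixed
  enumeration of the index type, followed by t.
\<close>
definition space_time_input :: "real ^ 'd \<Rightarrow> real \<Rightarrow> nat \<Rightarrow> real" where
  "space_time_input x t n = (if n < CARD('d) then x $ from_nat_into UNIV n else t)"

definition net_function :: "hlconc_net \<Rightarrow> real ^ 'd \<Rightarrow> real \<Rightarrow> real" where
  "net_function \<theta> x t = net_output \<theta> (space_time_input x t) 0"


section \<open>Time blocks, residuals and the constants of the error bound\<close>

definition time_step :: "real \<Rightarrow> nat \<Rightarrow> real" where
  "time_step T l = T / real l"

definition time_node :: "real \<Rightarrow> nat \<Rightarrow> nat \<Rightarrow> real" where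
  "time_node T l j = real j * time_step T l"

text \<open>
  In the following, U j and V j are the approximations on block j, where the values of U 0 and V 0
  at time 0 are the initial data.
\<close>

definition R_int1 ::
  "real \<Rightarrow> nat \<Rightarrow> (nat \<Rightarrow> real ^ 'd \<Rightarrow> real \<Rightarrow> real) \<Rightarrow> (nat \<Rightarrow> real ^ 'd \<Rightarrow> real \<Rightarrow> real)
   \<Rightarrow> nat \<Rightarrow> real ^ 'd \<Rightarrow> real \<Rightarrow> real" where
  "R_int1 T l U V i x t = partial_t (time_node T l i) (U i) x t - V i x t"

definition R_int2 ::
  "real \<Rightarrow> nat \<Rightarrow> (real ^ 'd \<Rightarrow> real \<Rightarrow> real)
   \<Rightarrow> (nat \<Rightarrow> real ^ 'd \<Rightarrow> real \<Rightarrow> real) \<Rightarrow> (nat \<Rightarrow> real ^ 'd \<Rightarrow> real \<Rightarrow> real)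
   \<Rightarrow> nat \<Rightarrow> real ^ 'd \<Rightarrow> real \<Rightarrow> real" where
  "R_int2 T l f U V i x t =
     partial_t (time_node T l i) (V i) x t - laplacian (\<lambda>y. U i y t) x - f x t"

text \<open>\<open>R_tb\<close> applied to U and to V gives \<open>R_tb1\<close> and \<open>R_tb2\<close>, at time node j - 1.\<close>

definition R_tb ::
  "real \<Rightarrow> nat \<Rightarrow> (nat \<Rightarrow> real ^ 'd \<Rightarrow> real \<Rightarrow> real) \<Rightarrow> nat \<Rightarrow> nat \<Rightarrow> real ^ 'd \<Rightarrow> real" where
  "R_tb T l W i j x = W i x (time_node T l (j - 1)) - W (j - 1) x (time_node T l (j - 1))"

definition R_sb1 ::
  "(nat \<Rightarrow> real ^ 'd \<Rightarrow> real \<Rightarrow> real) \<Rightarrow> nat \<Rightarrow> 'd \<Rightarrow> real ^ 'd \<Rightarrow> real \<Rightarrow> real" where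
  "R_sb1 V i k x t = V i x t - V i (opposite k x) t"

definition R_sb2 ::
  "(nat \<Rightarrow> real ^ 'd \<Rightarrow> real \<Rightarrow> real) \<Rightarrow> nat \<Rightarrow> 'd \<Rightarrow> real ^ 'd \<Rightarrow> real \<Rightarrow> real ^ 'd" where
  "R_sb2 U i k x t = grad (\<lambda>y. U i y t) x - grad (\<lambda>y. U i y t) (opposite k x)"

definition C_bdry1 ::
  "real \<Rightarrow> nat \<Rightarrow> (real ^ 'd \<Rightarrow> real \<Rightarrow> real) \<Rightarrow> (nat \<Rightarrow> real ^ 'd \<Rightarrow> real \<Rightarrow> real) \<Rightarrow> nat \<Rightarrow> real" where
  "C_bdry1 T l u U i =
     sqrt (surface_area TYPE('d)) *
     (C1_norm_bdry (time_node T l i) u + C1_norm_bdry (time_node T l i) (U i))"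

definition C_bdry2 ::
  "real \<Rightarrow> nat \<Rightarrow> (real ^ 'd \<Rightarrow> real \<Rightarrow> real) \<Rightarrow> (nat \<Rightarrow> real ^ 'd \<Rightarrow> real \<Rightarrow> real) \<Rightarrow> nat \<Rightarrow> real" where
  "C_bdry2 T l v V i =
     sqrt (surface_area TYPE('d)) *
     (sup_norm_bdry (time_node T l i) v + sup_norm_bdry (time_node T l i) (V i))"

definition C_tilde ::
  "real \<Rightarrow> nat \<Rightarrow> (real ^ 'd \<Rightarrow> real \<Rightarrow> real)
   \<Rightarrow> (real ^ 'd \<Rightarrow> real \<Rightarrow> real) \<Rightarrow> (real ^ 'd \<Rightarrow> real \<Rightarrow> real)
   \<Rightarrow> (nat \<Rightarrow> real ^ 'd \<Rightarrow> real \<Rightarrow> real) \<Rightarrow> (nat \<Rightarrow> real ^ 'd \<Rightarrow> real \<Rightarrow> real) \<Rightarrow> nat \<Rightarrow> real" where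
  "C_tilde T l f u v U V i =
     (LINT p : cell \<times> {time_node T l (i - 1)..time_node T l i} | lborel.
        (R_int1 T l U V i (fst p) (snd p))\<^sup>2 + (R_int2 T l f U V i (fst p) (snd p))\<^sup>2
        + (norm (grad (\<lambda>y. R_int1 T l U V i y (snd p)) (fst p)))\<^sup>2)
     + 2 * (\<Sum>j = 1..i. LINT x : cell | lborel.
         (R_tb T l U i j x)\<^sup>2 + (R_tb T l V i j x)\<^sup>2 + (norm (grad (R_tb T l U i j) x))\<^sup>2)
     + 2 * sqrt \<bar>time_step T l\<bar> * C_bdry1 T l u U i *
         sqrt (LINT t : {time_node T l (i - 1)..time_node T l i} | lborel.
                 surface_integral (\<lambda>k x. (R_sb1 V i k x t)\<^sup>2))
     + 2 * sqrt \<bar>time_step T l\<bar> * C_bdry2 T l v V i *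
         sqrt (LINT t : {time_node T l (i - 1)..time_node T l i} | lborel.
                 surface_integral (\<lambda>k x. (norm (R_sb2 U i k x t))\<^sup>2))"

primrec C_G ::
  "real \<Rightarrow> nat \<Rightarrow> (real ^ 'd \<Rightarrow> real \<Rightarrow> real)
   \<Rightarrow> (real ^ 'd \<Rightarrow> real \<Rightarrow> real) \<Rightarrow> (real ^ 'd \<Rightarrow> real \<Rightarrow> real)
   \<Rightarrow> (nat \<Rightarrow> real ^ 'd \<Rightarrow> real \<Rightarrow> real) \<Rightarrow> (nat \<Rightarrow> real ^ 'd \<Rightarrow> real \<Rightarrow> real) \<Rightarrow> nat \<Rightarrow> real" where
  "C_G T l f u v U V 0 = 0"
| "C_G T l f u v U V (Suc n) =
     C_tilde T l f u v U V (Suc n) + 2 * C_G T l f u v U V n * exp (2 * time_step T l)"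

end

theory Submission
  imports Defs
begin

text \<open>
  On the block that ends at time \<open>s\<close> put \<open>w = U - u\<close>, \<open>p = V - v\<close>, and let \<open>E(t)\<close> be the integral over
  the cell of \<open>w\<^sup>2 + |grad w|\<^sup>2 + p\<^sup>2\<close>. With the interior residuals \<open>q = R_int1\<close> and \<open>r = R_int2\<close> the
  errors satisfy \<open>w_t = p + q\<close> and \<open>p_t = laplacian w + r\<close>. Formally,
  \<open>E' = 2 \<integral> (w p + w q + grad q \<bullet> grad w + p r) + 2 \<integral>\<^sub>\<partial> p \<partial>\<^sub>n w\<close>, so Young's inequality gives
  \<open>E' \<le> 2 E + \<integral> (q\<^sup>2 + |grad q|\<^sup>2 + r\<^sup>2) + 2 \<integral>\<^sub>\<partial> p \<partial>\<^sub>n w\<close>.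

  The one delicate point is that \<open>v\<close> is not assumed to have a gradient, so \<open>|grad w|\<^sup>2\<close> cannot be
  differentiated under the integral sign. Instead, the function of two times
  \<open>\<Phi>(a, b) = \<integral> \<partial>\<^sub>k w(a) \<partial>\<^sub>k w(b)\<close> is symmetric, and integration by parts in space removes the derivative
  from the factor at time \<open>a\<close>. The result can be differentiated in \<open>a\<close>; by symmetry \<open>\<Phi>\<close> is continuously
  differentiable in both arguments, and the derivative on the diagonal is the desired one
  (\<open>deriv_grad_energy\<close>). Only \<open>q\<close>, which comes from the networks, is integrated by parts back.

  The boundary term is a sum over directions \<open>k\<close> of differences of \<open>p \<partial>\<^sub>k w\<close> between opposite faces. As \<open>v\<close>
  and \<open>grad u\<close> are periodic, the differences of \<open>p\<close> and of \<open>\<partial>\<^sub>k w\<close> are those of \<open>V\<close> and \<open>\<partial>\<^sub>k U\<close>, that is, the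
  boundary residuals; the other factors are bounded by the norms in \<open>C_bdry1\<close> and \<open>C_bdry2\<close>, and the
  Cauchy-Schwarz inequality on the faces and in time produces the two square roots (\<open>energy_bound\<close>).
  Gronwall's inequality then bounds \<open>E\<close> on the block by \<open>exp (2 * time_step T l)\<close> times its initial value plus the
  time integrals. The initial value is at most twice the temporal residual plus twice the energy of
  the previous block at its final time (\<open>energy_initial\<close>), and induction on the block finishes the
  proof (\<open>energy_le_C_G\<close>).

  All integrals are reduced to Henstock-Kurzweil integrals of continuous functions over \<open>cbox 0 1\<close>. The
  integral over a face is written as the integral over the cube of the integrand composed with
  the projection \<open>set_coord k a\<close> to that face, which is legitimate because the cube has unit edges.
\<close>

section \<open>Integrals over the unit cube and its faces\<close>


lemma cell_sandwich: "box 0 1 \<subseteq> (cell :: (real ^ 'd) set)" "(cell :: (real ^ 'd) set) \<subseteq> cbox 0 1"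
  by (auto simp: cell_def mem_box_cart less_imp_le)

lemma unit_box_nonempty: "box 0 (1 :: real ^ 'd) \<noteq> {}"
proof -
  have "(\<chi> k. 1/2) \<in> box 0 (1 :: real ^ 'd)" by (simp add: mem_box_cart)
  then show ?thesis by blast
qed

lemma closed_cell_eq: "closed_cell = (cbox 0 1 :: (real ^ 'd) set)"
proof
  show "closed_cell \<subseteq> (cbox 0 1 :: (real ^ 'd) set)"
    by (rule closure_minimal[OF cell_sandwich(2) closed_cbox])
  show "(cbox 0 1 :: (real ^ 'd) set) \<subseteq> closed_cell"
    using closure_mono[OF cell_sandwich(1)] unfolding closure_box[OF unit_box_nonempty] .
qed

lemma cell_boundary_eq: "cell_boundary = (cbox 0 1 - box 0 1 :: (real ^ 'd) set)"
proof -
  have "interior cell \<subseteq> (box 0 1 :: (real ^ 'd) set)"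
    using interior_mono[OF cell_sandwich(2)] unfolding interior_cbox .
  moreover have "box 0 1 \<subseteq> interior (cell :: (real ^ 'd) set)"
    by (rule interior_maximal[OF cell_sandwich(1) open_box])
  ultimately have "interior cell = (box 0 1 :: (real ^ 'd) set)" by (rule subset_antisym)
  then show ?thesis unfolding frontier_def closed_cell_eq by simp
qed

lemma cell_borel [measurable]: "cell \<in> sets (borel :: (real ^ 'd) measure)"
proof -
  have "cell = (\<Inter>k\<in>UNIV. {x :: real ^ 'd. 0 \<le> x $ k} \<inter> {x. x $ k < 1})"
    by (auto simp: cell_def)
  also have "\<dots> \<in> sets borel"
    by (intro sets.finite_INT sets.Int) (auto intro!: borel_closed borel_open
        closed_Collect_le open_Collect_less continuous_intros)
  finally show ?thesis .
qed

lemma negligible_closed_cell_minus_cell: "negligible (cbox 0 1 - cell :: (real ^ 'd) set)"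
  by (rule negligible_subset[OF negligible_frontier_interval[of 0 1]])
     (use cell_sandwich in blast)

lemma content_unit_cbox: "measure lborel (cbox 0 1 :: (real ^ 'd) set) = 1"
  by (subst content_cbox_cart) (auto simp: interval_ne_empty_cart)

text \<open>The half-open cell and the closed cube differ by a null set, so the integrand only needs to agree
  with a continuous function on the cell.\<close>
lemma LINT_cell:
  fixes g h :: "real ^ 'd \<Rightarrow> real"
  assumes "continuous_on (cbox 0 1) h" and "\<And>x. x \<in> cell \<Longrightarrow> g x = h x"
  shows "(LINT x : cell | lborel. g x) = integral (cbox 0 1) h"
proof -
  have "set_integrable lborel (cbox 0 1) h"
    unfolding set_integrable_def using assms(1) by (intro borel_integrable_compact) auto
  then have "set_integrable lborel cell h"
    by (rule set_integrable_subset) (use cell_sandwich in auto)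
  from set_borel_integral_eq_integral(2)[OF this]
  have "(LINT x : cell | lborel. g x) = integral cell h"
    using assms(2) by (subst set_lebesgue_integral_cong[where g = h]) auto
  also have "\<dots> = integral (cbox 0 1) h"
  proof (rule integral_spike_set)
    show "negligible {x \<in> cell - cbox 0 1. h x \<noteq> 0}"
      by (rule negligible_subset[of "{}"]) (use cell_sandwich in auto)
    show "negligible {x \<in> cbox 0 1 - cell. h x \<noteq> 0}"
      by (rule negligible_subset[OF negligible_closed_cell_minus_cell]) auto
  qed
  finally show ?thesis .
qed

lemma LINT_cell_times_interval:
  fixes g h :: "real ^ 'd \<Rightarrow> real \<Rightarrow> real"
  assumes "continuous_on (cbox 0 1 \<times> {a..b}) (\<lambda>(x, t). h x t)"
    and "\<And>x t. x \<in> cell \<Longrightarrow> t \<in> {a..b} \<Longrightarrow> g x t = h x t"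
  shows "(LINT p : cell \<times> {a..b} | lborel. g (fst p) (snd p)) =
    integral {a..b} (\<lambda>t. integral (cbox 0 1) (\<lambda>x. h x t))"
proof -
  have eq: "cbox (0, a) (1, b) = (cbox 0 1 :: (real ^ 'd) set) \<times> {a..b}"
    by (simp add: cbox_prod)
  have "cell \<times> {a..b} \<in> sets (borel \<Otimes>\<^sub>M borel :: ((real ^ 'd) \<times> real) measure)"
    by measurable
  then have m: "cell \<times> {a..b} \<in> sets (lborel :: ((real ^ 'd) \<times> real) measure)"
    unfolding borel_prod sets_lborel .
  have "set_integrable lborel (cbox (0, a) (1, b)) (\<lambda>p. h (fst p) (snd p))"
    unfolding set_integrable_def using assms(1) 
    by (intro borel_integrable_compact compact_cbox) (auto simp: eq case_prod_beta)
  then have "set_integrable lborel (cell \<times> {a..b}) (\<lambda>p. h (fst p) (snd p))"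
    by (rule set_integrable_subset) (use m cell_sandwich in \<open>auto simp: eq\<close>)
  from set_borel_integral_eq_integral(2)[OF this]
  have "(LINT p : cell \<times> {a..b} | lborel. g (fst p) (snd p)) =
      integral (cell \<times> {a..b}) (\<lambda>p. h (fst p) (snd p))"
    using assms(2) m by (subst set_lebesgue_integral_cong[where g = "\<lambda>p. h (fst p) (snd p)"]) auto
  also have "\<dots> = integral (cbox (0, a) (1, b)) (\<lambda>p. h (fst p) (snd p))"
  proof (rule integral_spike_set)
    show "negligible {p \<in> cell \<times> {a..b} - cbox (0, a) (1, b). h (fst p) (snd p) \<noteq> 0}"
      by (rule negligible_subset[of "{}"]) (use cell_sandwich in \<open>auto simp: eq\<close>)
    show "negligible {p \<in> cbox (0, a) (1, b) - cell \<times> {a..b}. h (fst p) (snd p) \<noteq> 0}"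
      by (rule negligible_subset[OF negligible_frontier_interval[of "(0, a)" "(1, b)"]])
        (use cell_sandwich(1) in \<open>auto simp: eq box_prod\<close>)
  qed
  also have "\<dots> = integral (cbox 0 1) (\<lambda>x. integral (cbox a b) (\<lambda>t. h x t))"
    using assms(1) by (subst integral_prod_continuous) (auto simp: eq case_prod_beta)
  also have "\<dots> = integral (cbox a b) (\<lambda>t. integral (cbox 0 1) (\<lambda>x. h x t))"
    by (rule integral_swap_continuous) (use assms(1) eq in simp)
  finally show ?thesis by simp
qed

lemma LINT_interval:
  fixes g h :: "real \<Rightarrow> real"
  assumes "continuous_on {a..b} h" and "\<And>t. t \<in> {a..b} \<Longrightarrow> g t = h t"
  shows "(LINT t : {a..b} | lborel. g t) = integral {a..b} h"
  using set_borel_integral_eq_integral(2)[OF borel_integrable_atLeastAtMost'[OF assms(1)]] assms(2)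
  by (subst set_lebesgue_integral_cong[where g = h]) auto

lemma vec_lambda_measurable [measurable]:
  "(\<lambda>y. \<chi> j. y j) \<in> (\<Pi>\<^sub>M j\<in>UNIV. restrict_space lborel {0..1}) \<rightarrow>\<^sub>M (borel :: (real ^ 'd) measure)"
proof -
  have "(\<lambda>y. (\<chi> j. y j) \<bullet> b) \<in> borel_measurable (\<Pi>\<^sub>M j\<in>UNIV. restrict_space lborel {0..1::real})"
    if "b \<in> Basis" for b :: "real ^ 'd"
  proof -
    obtain k where "b = axis k 1" using \<open>b \<in> Basis\<close> by (auto simp: Basis_vec_def)
    then have "(\<lambda>y. (\<chi> j. y j) \<bullet> b) = (\<lambda>y. y k)" by (auto simp: inner_axis)
    moreover have "(\<lambda>y. y k) \<in> (\<Pi>\<^sub>M j\<in>UNIV. restrict_space lborel {0..1}) \<rightarrow>\<^sub>M restrict_space lborel {0..1::real}"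
      by measurable
    then have "(\<lambda>y. y k) \<in> borel_measurable (\<Pi>\<^sub>M j\<in>UNIV. restrict_space lborel {0..1::real})"
      by (simp add: measurable_restrict_space2_iff)
    ultimately show ?thesis by simp
  qed
  then show ?thesis by (subst borel_measurable_euclidean_space) blast
qed

lemma unit_cube: "product_sigma_finite (\<lambda>_. restrict_space lborel {0..1::real})"
  unfolding product_sigma_finite_def
proof
  have "finite_measure (restrict_space lborel {0..1::real})"
    by (rule finite_measureI) (simp add: emeasure_restrict_space)
  then show "sigma_finite_measure (restrict_space lborel {0..1::real})"
    by (rule finite_measure.axioms(1))
qed

lemma emeasure_lborel_cbox_cart:
  "emeasure lborel (cbox a b) = (\<Prod>j\<in>UNIV. emeasure lborel {a $ j..b $ j})" for a b :: "real ^ 'd"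
proof (cases "\<forall>j. a $ j \<le> b $ j")
  case True
  have B: "(Basis :: (real ^ 'd) set) = (\<lambda>k. axis k 1) ` UNIV"
    unfolding Basis_vec_def by auto
  have inj: "inj (\<lambda>k :: 'd. axis k (1 :: real))"
    by (auto simp: inj_on_def axis_eq_axis)
  have "(\<Prod>c\<in>Basis. (b - a) \<bullet> c) = (\<Prod>j\<in>UNIV. b $ j - a $ j)"
    unfolding B by (subst prod.reindex[OF inj]) (simp add: inner_axis o_def)
  moreover have "\<forall>c\<in>Basis. a \<bullet> c \<le> b \<bullet> c"
    unfolding B using True by (simp add: inner_axis)
  ultimately have "emeasure lborel (cbox a b) = ennreal (\<Prod>j\<in>UNIV. b $ j - a $ j)"
    by (simp add: emeasure_lborel_cbox_eq)
  also have "\<dots> = (\<Prod>j\<in>UNIV. ennreal (b $ j - a $ j))"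
    by (rule prod_ennreal[symmetric]) (use True in simp)
  finally show ?thesis using True by simp
next
  case False
  then obtain j where j: "\<not> a $ j \<le> b $ j" by blast
  then have "cbox a b = {}" by (auto simp: mem_box_cart) (meson dual_order.trans not_le)
  moreover have "(\<Prod>j\<in>UNIV. emeasure lborel {a $ j..b $ j}) = 0"
    using j by (intro prod_zero) (auto intro!: exI[of _ j])
  ultimately show ?thesis by simp
qed

text \<open>The product of Lebesgue measures on unit intervals, over which face integrals are defined, is
  Lebesgue measure restricted to the cube.\<close>
lemma distr_unit_cube:
  "distr (\<Pi>\<^sub>M j\<in>UNIV. restrict_space lborel {0..1}) borel (\<lambda>y. \<chi> j. y j) =
   density lborel (indicator (cbox 0 (1 :: real ^ 'd)))" (is "?N = ?D")
proof (rule measure_eqI_generator_eq[symmetric])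
  interpret product_sigma_finite "\<lambda>_ :: 'd. restrict_space lborel {0..1::real}"
    by (rule unit_cube)
  have "emeasure ?N (cbox l u) = emeasure ?D (cbox l u)" for l u :: "real ^ 'd"
  proof -
    have "emeasure ?N (cbox l u) = emeasure (\<Pi>\<^sub>M j\<in>UNIV. restrict_space lborel {0..1})
        (\<Pi>\<^sub>E j\<in>UNIV. {l $ j..u $ j} \<inter> {0..1})"
      by (subst emeasure_distr)
        (auto intro!: arg_cong2[where f = emeasure] simp: space_PiM mem_box_cart PiE_def Pi_def)
    also have "\<dots> = (\<Prod>j\<in>UNIV. emeasure lborel {max (l $ j) 0..min (u $ j) 1})"
      by (subst emeasure_PiM)
        (auto simp: sets_restrict_space emeasure_restrict_space Int_commute intro!: prod.cong
           arg_cong2[where f = emeasure])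
    also have "\<dots> = emeasure lborel (cbox (\<chi> i. max (l $ i) 0) (\<chi> i. min (u $ i) 1))"
      by (simp add: emeasure_lborel_cbox_cart)
    also have "cbox (\<chi> i. max (l $ i) 0) (\<chi> i. min (u $ i) 1) = cbox 0 1 \<inter> cbox l u"
      by (auto simp: mem_box_cart)
    also have "emeasure lborel \<dots> = emeasure ?D (cbox l u)"
      by (subst emeasure_restricted) auto
    finally show ?thesis .
  qed
  then show "emeasure ?D X = emeasure ?N X" if "X \<in> range (\<lambda>(l, u). cbox l u)" for X
    using that by auto
  show "Int_stable (range (\<lambda>(l, u). cbox l u :: (real ^ 'd) set))"
    by (auto simp: Int_stable_def Int_interval)
  have "sets (borel :: (real ^ 'd) measure) = sigma_sets UNIV (range (\<lambda>(l, u). cbox l u))"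
    unfolding borel_eq_atLeastAtMost interval_cbox by simp
  then show "sets ?D = sigma_sets UNIV (range (\<lambda>(l, u). cbox l u))"
    "sets ?N = sigma_sets UNIV (range (\<lambda>(l, u). cbox l u))" by simp_all
  show "range (\<lambda>n. cbox (- (real n *\<^sub>R One)) (real n *\<^sub>R One)) \<subseteq> range (\<lambda>(l, u). cbox l u :: (real ^ 'd) set)"
    by auto
  show "(\<Union>n. cbox (- (real n *\<^sub>R One)) (real n *\<^sub>R One)) = (UNIV :: (real ^ 'd) set)"
  proof -
    have "(\<Union>n::nat. box (- (real n *\<^sub>R One)) (real n *\<^sub>R One)) \<subseteq>
        (\<Union>n::nat. cbox (- (real n *\<^sub>R One)) (real n *\<^sub>R One) :: (real ^ 'd) set)"
      by (intro UN_mono subset_refl box_subset_cbox)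
    then show ?thesis unfolding UN_box_eq_UNIV by (rule top.extremum_uniqueI)
  qed
  show "emeasure ?D (cbox (- (real n *\<^sub>R One)) (real n *\<^sub>R One)) \<noteq> \<infinity>" for n
  proof -
    have "emeasure ?D (cbox (- (real n *\<^sub>R One)) (real n *\<^sub>R One)) \<le> emeasure lborel (cbox 0 (1 :: real ^ 'd))"
      by (subst emeasure_restricted) (auto intro!: emeasure_mono)
    also have "\<dots> < \<infinity>" by (rule emeasure_lborel_cbox_finite)
    finally show ?thesis by simp
  qed
qed auto

lemma set_coord_nth [simp]: "set_coord k r x $ j = (if j = k then r else x $ j)"
  by (simp add: set_coord_def)

text \<open>The integral over the cube as an integral over a face of integrals over the segments
  orthogonal to that face.\<close>
lemma integral_cube_slices:
  fixes g :: "real ^ 'd \<Rightarrow> real"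
  assumes g: "continuous_on (cbox 0 1) g"
  shows "integral (cbox 0 1) g =
    (LINT y | (\<Pi>\<^sub>M j\<in>UNIV - {k}. restrict_space lborel {0..1}).
       integral {0..1} (\<lambda>r. g (\<chi> j. if j = k then r else y j)))"
proof -
  let ?g = "\<lambda>x. indicator (cbox 0 1) x *\<^sub>R g x"
  let ?R = "restrict_space lborel {0..1::real}"
  interpret product_sigma_finite "\<lambda>_ :: 'd. ?R"
    by (rule unit_cube)
  have int: "integrable lborel ?g"
    using g by (intro borel_integrable_compact) auto
  then have m: "?g \<in> borel_measurable borel"
    by (simp add: integrable_iff_bounded)
  have idem: "(\<lambda>x. indicator (cbox 0 1) x *\<^sub>R ?g x) = ?g"
    by (auto simp: indicator_def fun_eq_iff)
  have "integrable (density lborel (\<lambda>x. ennreal (indicator (cbox 0 1) x))) ?g"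
    by (subst integrable_density) (use m int in \<open>simp_all only: idem, simp_all\<close>)
  then have i1: "integrable (\<Pi>\<^sub>M j\<in>UNIV. ?R) (\<lambda>y. ?g (\<chi> j. y j))"
    using m by (subst integrable_distr_eq[symmetric, where N = borel])
      (simp_all add: distr_unit_cube ennreal_indicator vec_lambda_measurable)
  have "integral (cbox 0 1) g = (LINT x | lborel. ?g x)"
    using set_borel_integral_eq_integral(2)[of "cbox 0 1" g] int
    by (simp add: set_integrable_def set_lebesgue_integral_def)
  also have "\<dots> = (LINT x | density lborel (\<lambda>x. ennreal (indicator (cbox 0 1) x)). ?g x)"
    by (subst integral_density) (use m in \<open>simp_all only: idem, simp_all\<close>)
  also have "\<dots> = (LINT y | (\<Pi>\<^sub>M j\<in>UNIV. ?R). ?g (\<chi> j. y j))"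
    using m by (subst integral_distr[symmetric, where N = borel])
      (simp_all add: distr_unit_cube ennreal_indicator vec_lambda_measurable)
  also have "\<dots> = (LINT y | (\<Pi>\<^sub>M j\<in>insert k (UNIV - {k}). ?R). ?g (\<chi> j. y j))"
    by (simp add: insert_absorb)
  also have "\<dots> = (LINT y | (\<Pi>\<^sub>M j\<in>UNIV - {k}. ?R). (LINT r | ?R. ?g (\<chi> j. (y(k := r)) j)))"
    by (rule product_integral_insert) (use i1 in \<open>auto simp: insert_absorb\<close>)
  also have "\<dots> = (LINT y | (\<Pi>\<^sub>M j\<in>UNIV - {k}. ?R).
       integral {0..1} (\<lambda>r. g (\<chi> j. if j = k then r else y j)))"
  proof (rule Bochner_Integration.integral_cong[OF refl])
    fix y assume "y \<in> space (\<Pi>\<^sub>M j\<in>UNIV - {k}. ?R)"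
    then have y: "y j \<in> {0..1}" if "j \<noteq> k" for j
      using that by (auto simp: space_PiM PiE_def Pi_def)
    have "continuous_on {0..1} (\<lambda>r. g (\<chi> j. if j = k then r else y j))"
    proof (rule continuous_on_compose2[OF g])
      show "continuous_on {0..1} (\<lambda>r. \<chi> j. if j = k then r else y j)"
      proof (rule continuous_on_vec_lambda)
        show "continuous_on {0..1} (\<lambda>r. if j = k then r else y j)" for j
          by (cases "j = k") auto
      qed
    qed (use y in \<open>auto simp: mem_box_cart\<close>)
    note set_borel_integral_eq_integral(2)[OF borel_integrable_atLeastAtMost'[OF this]]
    moreover have "(LINT r | ?R. ?g (\<chi> j. (y(k := r)) j)) =
        (LINT r : {0..1} | lborel. g (\<chi> j. if j = k then r else y j))"
      unfolding set_lebesgue_integral_def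
      by (subst integral_restrict_space)
        (use y in \<open>auto simp: fun_upd_def indicator_def mem_box_cart intro!: Bochner_Integration.integral_cong\<close>)
    ultimately show "(LINT r | ?R. ?g (\<chi> j. (y(k := r)) j)) =
        integral {0..1} (\<lambda>r. g (\<chi> j. if j = k then r else y j))" by simp
  qed
  finally show ?thesis .
qed

lemma set_coord_in_cbox:
  "x \<in> cbox 0 1 \<Longrightarrow> r \<in> {0..1} \<Longrightarrow> set_coord k r x \<in> cbox 0 (1 :: real ^ 'd)"
  by (auto simp: mem_box_cart)

lemma continuous_on_set_coord [continuous_intros]:
  assumes "continuous_on A f" "continuous_on A g"
  shows "continuous_on A (\<lambda>a. set_coord k (f a) (g a))"
  unfolding set_coord_def
proof (rule continuous_on_vec_lambda)
  show "continuous_on A (\<lambda>a. if j = k then f a else g a $ j)" for j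
    using assms by (cases "j = k") (auto intro: continuous_intros)
qed

lemma set_coord_self [simp]: "set_coord k (x $ k) x = x"
  by (simp add: set_coord_def vec_eq_iff)

lemma set_coord_twice [simp]: "set_coord k r (set_coord k r' x) = set_coord k r x"
  by (simp add: set_coord_def vec_eq_iff)

lemma set_coord_slice: "set_coord k a (\<chi> j. if j = k then r else y j) = (\<chi> j. if j = k then a else y j)"
  by (simp add: set_coord_def vec_eq_iff)

text \<open>Averaging over the extra coordinate k, on which the integrand does not depend, changes nothing
  because the edge length is 1.\<close>
lemma face_integral_eq:
  fixes g :: "real ^ 'd \<Rightarrow> real"
  assumes g: "continuous_on (cbox 0 1) g" and a: "a \<in> {0..1}"
  shows "face_integral k a g = integral (cbox 0 1) (\<lambda>x. g (set_coord k a x))"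
proof -
  have "continuous_on (cbox 0 1) (\<lambda>x. g (set_coord k a x))"
    by (intro continuous_on_compose2[OF g] continuous_intros) (use a set_coord_in_cbox in auto)
  from integral_cube_slices[OF this, of k] show ?thesis
    by (simp add: face_integral_def set_coord_slice)
qed

section \<open>Partial derivatives and integration by parts\<close>

text \<open>
  Partial derivatives on the closed cube in space, and on the closed interval [0, s] in time, as
  relations between a function and its derivative; they are one-sided at the ends.
\<close>
definition has_partial_x :: "'d \<Rightarrow> (real ^ 'd \<Rightarrow> real) \<Rightarrow> (real ^ 'd \<Rightarrow> real) \<Rightarrow> bool" where
  "has_partial_x k g g' \<longleftrightarrow> (\<forall>x\<in>cbox 0 1.
     ((\<lambda>r. g (set_coord k r x)) has_real_derivative g' x) (at (x $ k) within {0..1}))"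

definition has_partial_t :: "real \<Rightarrow> (real ^ 'd \<Rightarrow> real \<Rightarrow> real) \<Rightarrow> (real ^ 'd \<Rightarrow> real \<Rightarrow> real) \<Rightarrow> bool" where
  "has_partial_t s w w' \<longleftrightarrow> (\<forall>x\<in>cbox 0 1. \<forall>t\<in>{0..s}.
     (w x has_real_derivative w' x t) (at t within {0..s}))"

text \<open>The divergence theorem on the cube, for one component.\<close>
lemma integral_partial_x:
  fixes g g' :: "real ^ 'd \<Rightarrow> real"
  assumes g: "continuous_on (cbox 0 1) g" and g': "continuous_on (cbox 0 1) g'"
    and d: "has_partial_x k g g'"
  shows "integral (cbox 0 1) g' =
    integral (cbox 0 1) (\<lambda>x. g (set_coord k 1 x) - g (set_coord k 0 x))"
proof -
  have "continuous_on (cbox 0 1) (\<lambda>x. g (set_coord k 1 x) - g (set_coord k 0 x))"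
    by (intro continuous_intros continuous_on_compose2[OF g]) (auto intro: set_coord_in_cbox)
  note * = integral_cube_slices[OF this, of k]
  show ?thesis
    unfolding * unfolding integral_cube_slices[OF g', of k]
  proof (rule Bochner_Integration.integral_cong[OF refl])
    fix y assume "y \<in> space (\<Pi>\<^sub>M j\<in>UNIV - {k}. restrict_space lborel {0..1::real})"
    then have y: "y j \<in> {0..1}" if "j \<noteq> k" for j
      using that by (auto simp: space_PiM PiE_def Pi_def)
    let ?x = "\<lambda>r. \<chi> j. if j = k then r else y j"
    have "((\<lambda>r. g' (?x r)) has_integral g (?x 1) - g (?x 0)) {0..1}"
    proof (rule fundamental_theorem_of_calculus)
      fix r :: real assume "r \<in> {0..1}"
      then have "?x r \<in> cbox 0 1" using y by (auto simp: mem_box_cart)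
      with d show "((\<lambda>r. g (?x r)) has_vector_derivative g' (?x r)) (at r within {0..1})"
        by (auto simp: has_partial_x_def set_coord_slice has_real_derivative_iff_has_vector_derivative
            dest!: bspec)
    qed simp
    then show "integral {0..1} (\<lambda>r. g' (?x r)) =
        integral {0..1} (\<lambda>r. g (set_coord k 1 (?x r)) - g (set_coord k 0 (?x r)))"
      by (simp add: set_coord_slice integral_unique)
  qed
qed

lemma has_partial_x_mult:
  fixes g g' h h' :: "real ^ 'd \<Rightarrow> real"
  assumes "has_partial_x k g g'" "has_partial_x k h h'"
  shows "has_partial_x k (\<lambda>x. g x * h x) (\<lambda>x. g' x * h x + g x * h' x)"
  unfolding has_partial_x_def
proof
  fix x :: "real ^ 'd" assume x: "x \<in> cbox 0 1"
  note DERIV_mult[OF assms(1)[unfolded has_partial_x_def, THEN bspec, OF x]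
    assms(2)[unfolded has_partial_x_def, THEN bspec, OF x]]
  then show "((\<lambda>r. g (set_coord k r x) * h (set_coord k r x)) has_real_derivative
      g' x * h x + g x * h' x) (at (x $ k) within {0..1})"
    by (simp add: mult.commute add.commute)
qed

lemma integral_by_parts_x:
  fixes g g' :: "real ^ 'd \<Rightarrow> real"
  assumes [continuous_intros]: "continuous_on (cbox 0 1) g" "continuous_on (cbox 0 1) g'"
    "continuous_on (cbox 0 1) h" "continuous_on (cbox 0 1) h'"
    and "has_partial_x k g g'" "has_partial_x k h h'"
  shows "integral (cbox 0 1) (\<lambda>x. g' x * h x) =
    integral (cbox 0 1) (\<lambda>x. g (set_coord k 1 x) * h (set_coord k 1 x)
      - g (set_coord k 0 x) * h (set_coord k 0 x) - g x * h' x)"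
proof -
  have c: "continuous_on (cbox 0 1) (\<lambda>x. g (set_coord k a x) * h (set_coord k a x))"
    if "a \<in> {0..1}" for a
    by (intro continuous_intros continuous_on_compose2[OF assms(1)] continuous_on_compose2[OF assms(3)])
      (use that in \<open>auto intro: set_coord_in_cbox\<close>)
  have "integral (cbox 0 1) (\<lambda>x. g' x * h x) =
      integral (cbox 0 1) (\<lambda>x. (g' x * h x + g x * h' x) - g x * h' x)" by simp
  also have "\<dots> = integral (cbox 0 1) (\<lambda>x. g' x * h x + g x * h' x) - integral (cbox 0 1) (\<lambda>x. g x * h' x)"
    by (intro integral_diff integrable_continuous continuous_intros)
  also have "integral (cbox 0 1) (\<lambda>x. g' x * h x + g x * h' x) =
      integral (cbox 0 1) (\<lambda>x. g (set_coord k 1 x) * h (set_coord k 1 x)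
      - g (set_coord k 0 x) * h (set_coord k 0 x))"
    by (intro integral_partial_x has_partial_x_mult assms continuous_intros)
  also have "\<dots> - integral (cbox 0 1) (\<lambda>x. g x * h' x) = 
    integral (cbox 0 1) (\<lambda>x. g (set_coord k 1 x) * h (set_coord k 1 x)
      - g (set_coord k 0 x) * h (set_coord k 0 x) - g x * h' x)"
    by (intro integral_diff[symmetric] integrable_continuous continuous_intros c) auto
  finally show ?thesis .
qed

section \<open>Continuous functions on the space-time cylinder\<close>

lemma C0_upto_compose:
  assumes "C0_upto s w" "continuous_on A f" "continuous_on A g"
    and "\<And>a. a \<in> A \<Longrightarrow> f a \<in> cbox 0 1" "\<And>a. a \<in> A \<Longrightarrow> g a \<in> {0..s}"
  shows "continuous_on A (\<lambda>a. w (f a) (g a))"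
  using continuous_on_compose2[OF assms(1)[unfolded C0_upto_def closed_cell_eq],
      of A "\<lambda>a. (f a, g a)"] assms(2-5)
  by (auto simp: image_subset_iff intro: continuous_intros)

text \<open>The Cauchy-Schwarz inequality against a constant, from the nonnegative variance of h.\<close>
lemma square_integral_le:
  fixes h :: "'a::euclidean_space \<Rightarrow> real"
  assumes [continuous_intros]: "continuous_on (cbox a b) h"
  shows "(integral (cbox a b) h)\<^sup>2 \<le> measure lborel (cbox a b) * integral (cbox a b) (\<lambda>x. (h x)\<^sup>2)"
proof (cases "measure lborel (cbox a b) = 0")
  case True
  then have "negligible (cbox a b)"
    by (simp add: negligible_iff_measure0 fmeasurable_cbox content_eq_0_interior negligible_interval(1))
  then show ?thesis using True by (simp add: content_0)
next
  case False
  let ?c = "measure lborel (cbox a b)"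
  define m where "m = integral (cbox a b) h / ?c"
  have i1: "((\<lambda>x. (h x)\<^sup>2) has_integral integral (cbox a b) (\<lambda>x. (h x)\<^sup>2)) (cbox a b)"
    by (intro integrable_integral integrable_continuous continuous_on_power assms)
  have i2: "(h has_integral integral (cbox a b) h) (cbox a b)"
    by (intro integrable_integral integrable_continuous assms)
  have "((\<lambda>x. (h x)\<^sup>2 - 2 * m * h x + m\<^sup>2) has_integral
      integral (cbox a b) (\<lambda>x. (h x)\<^sup>2) - 2 * m * integral (cbox a b) h + ?c *\<^sub>R m\<^sup>2) (cbox a b)"
    by (intro has_integral_add has_integral_diff has_integral_mult_right has_integral_const i1 i2)
  moreover have "(h x)\<^sup>2 - 2 * m * h x + m\<^sup>2 = (h x - m)\<^sup>2" for x
    by (simp add: power2_eq_square algebra_simps)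
  ultimately have "((\<lambda>x. (h x - m)\<^sup>2) has_integral
      integral (cbox a b) (\<lambda>x. (h x)\<^sup>2) - 2 * m * integral (cbox a b) h + ?c *\<^sub>R m\<^sup>2) (cbox a b)"
    by (simp only:)
  from has_integral_nonneg[OF this]
  have "0 \<le> integral (cbox a b) (\<lambda>x. (h x)\<^sup>2) - 2 * m * integral (cbox a b) h + ?c *\<^sub>R m\<^sup>2"
    by simp
  then have "0 \<le> (integral (cbox a b) (\<lambda>x. (h x)\<^sup>2) - 2 * m * integral (cbox a b) h + m\<^sup>2 * ?c) * ?c"
    by (simp add: mult.commute)
  also have "\<dots> = ?c * integral (cbox a b) (\<lambda>x. (h x)\<^sup>2) - (integral (cbox a b) h)\<^sup>2"
    using False by (simp add: m_def field_simps power2_eq_square)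
  finally show ?thesis by simp
qed

text \<open>A symmetric function of two variables with a continuous partial derivative in the first one has
  the other one as well, hence is differentiable along the diagonal.\<close>
lemma DERIV_diagonal_symmetric:
  fixes f :: "real \<Rightarrow> real \<Rightarrow> real"
  assumes d: "\<And>a b. a \<in> {0..s} \<Longrightarrow> b \<in> {0..s} \<Longrightarrow>
      ((\<lambda>a. f a b) has_real_derivative f' a b) (at a within {0..s})"
    and sym: "\<And>a b. f a b = f b a"
    and c: "continuous_on ({0..s} \<times> {0..s}) (\<lambda>(a, b). f' a b)"
    and t: "t \<in> {0..s}"
  shows "((\<lambda>t. f t t) has_real_derivative 2 * f' t t) (at t within {0..s})"
proof -
  let ?I = "{0..s}"
  have d2: "((\<lambda>b. f a b) has_derivative blinfun_apply (blinfun_scaleR_left (f' b a))) (at b within ?I)"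
    if "a \<in> ?I" "b \<in> ?I" for a b
  proof -
    have "((\<lambda>b. f b a) has_derivative (\<lambda>h. h * f' b a)) (at b within ?I)"
      using d[OF that(2,1)] by (simp add: has_field_derivative_def mult_commute_abs)
    moreover have "(\<lambda>b. f b a) = (\<lambda>b. f a b)" by (simp add: sym[of a])
    ultimately show ?thesis by (simp add: blinfun_scaleR_left.rep_eq)
  qed
  have "continuous_on (?I \<times> ?I) (\<lambda>p. blinfun_scaleR_left (f' (snd p) (fst p)))"
    by (intro bounded_linear.continuous_on[OF bounded_linear_blinfun_scaleR_left]
        continuous_on_compose2[OF c[unfolded case_prod_beta], where f = "\<lambda>p. (snd p, fst p)", simplified]
        continuous_intros) auto
  then have c2: "continuous (at (t, t) within ?I \<times> ?I) (\<lambda>(a, b). blinfun_scaleR_left (f' b a))"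
    unfolding case_prod_beta continuous_on_eq_continuous_within using t by blast
  have "((\<lambda>a. f a t) has_derivative (\<lambda>h. h * f' t t)) (at t within ?I)"
    using d[OF t t] by (simp add: has_field_derivative_def mult_commute_abs)
  from has_derivative_partialsI[where X = ?I and Y = ?I, OF this d2 c2 t]
  have D: "((\<lambda>(a, b). f a b) has_derivative (\<lambda>(h, k). h * f' t t + k * f' t t)) (at (t, t) within ?I \<times> ?I)"
    by (simp add: blinfun_scaleR_left.rep_eq)
  have diag: "((\<lambda>t. (t, t)) has_derivative (\<lambda>h. (h, h))) (at t within ?I)"
    by (intro derivative_intros)
  have "((\<lambda>(a, b). f a b) has_derivative (\<lambda>(h, k). h * f' t t + k * f' t t))
      (at (t, t) within (\<lambda>t. (t, t)) ` ?I)"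
    by (rule has_derivative_subset[OF D]) auto
  from has_derivative_in_compose[OF diag this]
  have "((\<lambda>t. f t t) has_derivative (\<lambda>h. h * f' t t + h * f' t t)) (at t within ?I)"
    by (simp only: split_conv)
  moreover have "(\<lambda>h. h * f' t t + h * f' t t) = (*) (2 * f' t t)"
    by auto
  ultimately show ?thesis by (simp add: has_field_derivative_def)
qed

text \<open>Differentiation under the integral sign.\<close>
lemma has_real_derivative_integral:
  fixes g g' :: "real ^ 'd \<Rightarrow> real \<Rightarrow> real"
  assumes d: "\<And>x t. x \<in> cbox 0 1 \<Longrightarrow> t \<in> {0..s} \<Longrightarrow>
      (g x has_real_derivative g' x t) (at t within {0..s})"
    and g: "\<And>t. t \<in> {0..s} \<Longrightarrow> continuous_on (cbox 0 1) (\<lambda>x. g x t)"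
    and c: "C0_upto s g'" and t: "t \<in> {0..s}"
  shows "((\<lambda>t. integral (cbox 0 1) (\<lambda>x. g x t)) has_real_derivative
           integral (cbox 0 1) (\<lambda>x. g' x t)) (at t within {0..s})"
  unfolding has_real_derivative_iff_has_vector_derivative
proof (rule leibniz_rule_vector_derivative)
  show "continuous_on ({0..s} \<times> cbox 0 1) (\<lambda>(t, x). g' x t)"
    unfolding case_prod_beta by (intro C0_upto_compose[OF c] continuous_intros) auto
qed (use d g t in \<open>auto simp: has_real_derivative_iff_has_vector_derivative intro!: integrable_continuous\<close>)

lemma continuous_on_integral_cube:
  assumes "C0_upto s g"
  shows "continuous_on {0..s} (\<lambda>t. integral (cbox 0 1) (\<lambda>x. g x t))"
proof (rule integral_continuous_on_param)
  show "continuous_on ({0..s} \<times> cbox 0 1) (\<lambda>(t, x). g x t)"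
    unfolding case_prod_beta by (intro C0_upto_compose[OF assms] continuous_intros) auto
qed

lemma C0_upto_const [simp]: "C0_upto s (\<lambda>x t. c)"
  and C0_upto_add: "C0_upto s g \<Longrightarrow> C0_upto s h \<Longrightarrow> C0_upto s (\<lambda>x t. g x t + h x t)"
  and C0_upto_diff: "C0_upto s g \<Longrightarrow> C0_upto s h \<Longrightarrow> C0_upto s (\<lambda>x t. g x t - h x t)"
  and C0_upto_mult: "C0_upto s g \<Longrightarrow> C0_upto s h \<Longrightarrow> C0_upto s (\<lambda>x t. g x t * h x t)"
  and C0_upto_power: "C0_upto s g \<Longrightarrow> C0_upto s (\<lambda>x t. g x t ^ n)"
  and C0_upto_abs: "C0_upto s g \<Longrightarrow> C0_upto s (\<lambda>x t. \<bar>g x t\<bar>)"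
  and C0_upto_sum: "(\<And>k. k \<in> K \<Longrightarrow> C0_upto s (G k)) \<Longrightarrow> C0_upto s (\<lambda>x t. \<Sum>k\<in>K. G k x t)"
  for G :: "'k::finite \<Rightarrow> _"
  by (auto simp: C0_upto_def case_prod_beta intro!: continuous_intros)

lemma C0_upto_set_coord:
  "C0_upto s g \<Longrightarrow> a \<in> {0..1} \<Longrightarrow> C0_upto s (\<lambda>x t. g (set_coord k a x) t)"
  unfolding C0_upto_def[of _ "\<lambda>x t. g (set_coord k a x) t"] closed_cell_eq case_prod_beta
  by (rule C0_upto_compose[of s g]) (auto intro: set_coord_in_cbox intro!: continuous_intros)

lemmas C0_upto_intros = C0_upto_const C0_upto_add C0_upto_diff C0_upto_mult C0_upto_power
  C0_upto_abs C0_upto_sum C0_upto_set_coord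

lemma C0_upto_slice: "C0_upto s g \<Longrightarrow> t \<in> {0..s} \<Longrightarrow> continuous_on (cbox 0 1) (\<lambda>x. g x t)"
  by (rule C0_upto_compose[of s g]) auto

section \<open>The energy of the error\<close>

text \<open>
  The error equations \<open>w_t = z = p + q\<close>, with \<open>p_t\<close> written \<open>p'\<close>. The functions \<open>w1 k\<close>, \<open>w2 k\<close> are the first and
  second derivatives of w in direction k, and \<open>q1 k\<close> is the derivative of q. No derivative of p
  or z in space is assumed.
\<close>
locale wave_error =
  fixes s :: real and w z p p' q :: "real ^ 'd \<Rightarrow> real \<Rightarrow> real"
    and w1 w2 q1 :: "'d \<Rightarrow> real ^ 'd \<Rightarrow> real \<Rightarrow> real"
  assumes s: "0 < s"
    and C0 [intro]: "C0_upto s w" "C0_upto s z" "C0_upto s p" "C0_upto s p'" "C0_upto s q"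
      "C0_upto s (w1 k)" "C0_upto s (w2 k)" "C0_upto s (q1 k)"
    and w_t: "has_partial_t s w z" and p_t: "has_partial_t s p p'"
    and w_x: "t \<in> {0..s} \<Longrightarrow> has_partial_x k (\<lambda>x. w x t) (\<lambda>x. w1 k x t)"
    and w1_x: "t \<in> {0..s} \<Longrightarrow> has_partial_x k (\<lambda>x. w1 k x t) (\<lambda>x. w2 k x t)"
    and q_x: "t \<in> {0..s} \<Longrightarrow> has_partial_x k (\<lambda>x. q x t) (\<lambda>x. q1 k x t)"
    and z: "x \<in> cbox 0 1 \<Longrightarrow> t \<in> {0..s} \<Longrightarrow> z x t = p x t + q x t"
begin

lemmas C0_continuous_intros = C0[THEN C0_upto_compose]

text \<open>The integral over the cell of \<open>w\<^sup>2 + |grad w|\<^sup>2 + p\<^sup>2\<close>.\<close>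
definition energy :: "real \<Rightarrow> real" where
  "energy t = integral (cbox 0 1) (\<lambda>x. (w x t)\<^sup>2 + (\<Sum>k\<in>UNIV. (w1 k x t)\<^sup>2) + (p x t)\<^sup>2)"

text \<open>The integral over the boundary of p times the outward normal derivative of w, with the two faces
  orthogonal to direction k projected from the cube.\<close>
definition boundary_flux :: "real \<Rightarrow> real" where
  "boundary_flux t = (\<Sum>k\<in>UNIV. integral (cbox 0 1) (\<lambda>x.
     p (set_coord k 1 x) t * w1 k (set_coord k 1 x) t - p (set_coord k 0 x) t * w1 k (set_coord k 0 x) t))"

text \<open>The squared residuals of the two equations and of the gradient of the first one.\<close>
definition residual :: "real \<Rightarrow> real" where
  "residual t = integral (cbox 0 1) (\<lambda>x.
     (q x t)\<^sup>2 + (p' x t - (\<Sum>k\<in>UNIV. w2 k x t))\<^sup>2 + (\<Sum>k\<in>UNIV. (q1 k x t)\<^sup>2))"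

lemma integrable_C0: "C0_upto s g \<Longrightarrow> t \<in> {0..s} \<Longrightarrow> (\<lambda>x. g x t) integrable_on cbox 0 1"
  by (intro integrable_continuous C0_upto_slice)

text \<open>
  The derivative of the integral of \<open>(w1 k)\<^sup>2\<close>, obtained without a derivative of \<open>w1 k\<close> in time: the
  integral of \<open>w1 k x a * w1 k x b\<close> is first integrated by parts, which moves the derivative in direction k
  away from the factor at time a.
\<close>
lemma deriv_grad_energy:
  assumes t: "t \<in> {0..s}"
  shows "((\<lambda>t. integral (cbox 0 1) (\<lambda>x. (w1 k x t)\<^sup>2)) has_real_derivative
    2 * (integral (cbox 0 1) (\<lambda>x. p (set_coord k 1 x) t * w1 k (set_coord k 1 x) t
         - p (set_coord k 0 x) t * w1 k (set_coord k 0 x) t)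
      + integral (cbox 0 1) (\<lambda>x. q1 k x t * w1 k x t - p x t * w2 k x t))) (at t within {0..s})"
proof -
  define \<Phi> where "\<Phi> a b = integral (cbox 0 1) (\<lambda>x. w1 k x a * w1 k x b)" for a b
  define H where "H y x a b = y (set_coord k 1 x) a * w1 k (set_coord k 1 x) b
     - y (set_coord k 0 x) a * w1 k (set_coord k 0 x) b - y x a * w2 k x b"
    for y :: "real ^ 'd \<Rightarrow> real \<Rightarrow> real" and x a b
  \<comment> \<open>\<open>H w x a b\<close> is the integrand after integration by parts. It is linear in \<open>w\<close> at time \<open>a\<close>,
    so its derivative in \<open>a\<close> is \<open>H z x a b\<close>.\<close>
  have H0: "C0_upto s (\<lambda>x a. H y x a b)" if "C0_upto s y" "b \<in> {0..s}" for y b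
  proof -
    have "C0_upto s (\<lambda>x a. w1 k x b)" "C0_upto s (\<lambda>x a. w2 k x b)"
      using that(2) unfolding C0_upto_def[of s "\<lambda>x a. w1 k x b"] C0_upto_def[of s "\<lambda>x a. w2 k x b"]
         case_prod_beta closed_cell_eq
      by (auto intro!: continuous_intros C0_continuous_intros)
    note 1 = this C0_upto_set_coord[OF this(1)]
    show ?thesis
      unfolding H_def using that(1)
      by (intro C0_upto_intros 1) auto
  qed
  have \<Phi>: "\<Phi> a b = integral (cbox 0 1) (\<lambda>x. H w x a b)" if "a \<in> {0..s}" "b \<in> {0..s}" for a b
    unfolding \<Phi>_def H_def
    by (rule integral_by_parts_x) (use that in \<open>auto intro: C0_upto_slice w_x w1_x\<close>)
  have d\<Phi>: "((\<lambda>a. \<Phi> a b) has_real_derivative integral (cbox 0 1) (\<lambda>x. H z x a b)) (at a within {0..s})"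
    if a: "a \<in> {0..s}" and b: "b \<in> {0..s}" for a b
  proof -
    have w: "((\<lambda>a. w x a) has_real_derivative z x a) (at a within {0..s})"
      if "x \<in> cbox 0 1" "a \<in> {0..s}" for x a
      using w_t that by (auto simp: has_partial_t_def)
    have "((\<lambda>a. H w x a b) has_real_derivative H z x a b) (at a within {0..s})"
      if "x \<in> cbox 0 1" "a \<in> {0..s}" for x a
      unfolding H_def
      by (intro DERIV_diff DERIV_cmult_right w) (use that in \<open>auto intro: set_coord_in_cbox\<close>)
    then have "((\<lambda>a. integral (cbox 0 1) (\<lambda>x. H w x a b)) has_real_derivative
        integral (cbox 0 1) (\<lambda>x. H z x a b)) (at a within {0..s})"
      using a b by (intro has_real_derivative_integral) (auto intro!: C0_upto_slice[OF H0] H0)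
    then show ?thesis
      unfolding has_field_derivative_def by (rule has_derivative_transform[rotated 2]) (use a b \<Phi> in auto)
  qed
  have "continuous_on ({0..s} \<times> {0..s}) (\<lambda>p. integral (cbox 0 1) (\<lambda>x. H z x (fst p) (snd p)))"
    by (rule integral_continuous_on_param)
      (auto simp: H_def case_prod_beta intro!: continuous_intros C0_continuous_intros set_coord_in_cbox)
  then have c\<Phi>: "continuous_on ({0..s} \<times> {0..s}) (\<lambda>(a, b). integral (cbox 0 1) (\<lambda>x. H z x a b))"
    by (simp add: case_prod_beta)
  have "((\<lambda>t. \<Phi> t t) has_real_derivative 2 * integral (cbox 0 1) (\<lambda>x. H z x t t)) (at t within {0..s})"
    by (rule DERIV_diagonal_symmetric[OF d\<Phi> _ c\<Phi> t]) (auto simp: \<Phi>_def mult.commute)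
  moreover have "integral (cbox 0 1) (\<lambda>x. H z x t t) =
      integral (cbox 0 1) (\<lambda>x. p (set_coord k 1 x) t * w1 k (set_coord k 1 x) t
         - p (set_coord k 0 x) t * w1 k (set_coord k 0 x) t)
      + integral (cbox 0 1) (\<lambda>x. q1 k x t * w1 k x t - p x t * w2 k x t)"
  proof -
    have B: "C0_upto s (\<lambda>x t. p (set_coord k 1 x) t * w1 k (set_coord k 1 x) t
         - p (set_coord k 0 x) t * w1 k (set_coord k 0 x) t)"
      by (auto intro!: C0_upto_intros)
    have qw: "C0_upto s (\<lambda>x t. q1 k x t * w1 k x t)" and pw: "C0_upto s (\<lambda>x t. p x t * w2 k x t)"
      by (auto intro!: C0_upto_intros)
    have "integral (cbox 0 1) (\<lambda>x. H z x t t) = integral (cbox 0 1) (\<lambda>x. H p x t t + H q x t t)"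
      by (rule integral_cong) (use t in \<open>auto simp: H_def z set_coord_in_cbox algebra_simps\<close>)
    also have "\<dots> = integral (cbox 0 1) (\<lambda>x. H p x t t) + integral (cbox 0 1) (\<lambda>x. H q x t t)"
      by (intro integral_add integrable_continuous C0_upto_slice[OF H0] C0 t)
    \<comment> \<open>Only q, whose derivative exists, is integrated by parts back.\<close>
    also have "integral (cbox 0 1) (\<lambda>x. H q x t t) = integral (cbox 0 1) (\<lambda>x. q1 k x t * w1 k x t)"
      unfolding H_def
      by (rule integral_by_parts_x[symmetric]) (use t in \<open>auto intro: C0_upto_slice q_x w1_x\<close>)
    also have "integral (cbox 0 1) (\<lambda>x. H p x t t) =
        integral (cbox 0 1) (\<lambda>x. p (set_coord k 1 x) t * w1 k (set_coord k 1 x) t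
           - p (set_coord k 0 x) t * w1 k (set_coord k 0 x) t)
        - integral (cbox 0 1) (\<lambda>x. p x t * w2 k x t)"
      unfolding H_def by (rule integral_diff) (auto intro!: integrable_C0 t B pw)
    finally show ?thesis
      using integral_diff[OF integrable_C0[OF qw t] integrable_C0[OF pw t]] by simp
  qed
  ultimately show ?thesis by (simp add: \<Phi>_def power2_eq_square)
qed

end

section \<open>Gronwall's inequality and the Cauchy-Schwarz inequality for jumps\<close>

lemma gronwall:
  fixes E \<rho> :: "real \<Rightarrow> real"
  assumes E: "\<And>t. t \<in> {a..b} \<Longrightarrow> (E has_real_derivative E' t) (at t within {a..b})"
    and le: "\<And>t. t \<in> {a..b} \<Longrightarrow> E' t \<le> c * E t + \<rho> t"
    and \<rho>: "continuous_on {a..b} \<rho>" "\<And>t. t \<in> {a..b} \<Longrightarrow> 0 \<le> \<rho> t"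
    and c: "0 \<le> c" and \<tau>: "\<tau> \<in> {a..b}"
  shows "E \<tau> \<le> exp (c * (\<tau> - a)) * (E a + integral {a..b} \<rho>)"
proof -
  \<comment> \<open>The integrating factor turns the hypothesis into the monotonicity of F.\<close>
  define F where "F t = exp (- c * (t - a)) * E t - integral {a..t} \<rho>" for t
  define F' where "F' t = exp (- c * (t - a)) * (E' t - c * E t) - \<rho> t" for t
  have F: "(F has_real_derivative F' t) (at t within {a..b})" if "t \<in> {a..b}" for t
    unfolding F_def F'_def
    by (rule derivative_eq_intros E[OF that] integral_has_real_derivative[OF \<rho>(1) that] refl)+
      (simp add: algebra_simps)
  have "F' t \<le> 0" if t: "t \<in> {a..b}" for t
  proof -
    have "exp (- c * (t - a)) * (E' t - c * E t) \<le> exp (- c * (t - a)) * \<rho> t"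
      using le[OF t] by (intro mult_left_mono) auto
    also have "\<dots> \<le> 1 * \<rho> t"
      using \<rho>(2)[OF t] c t by (intro mult_right_mono) (auto simp: mult_nonneg_nonneg)
    finally show ?thesis by (simp add: F'_def)
  qed
  note neg = this
  have "F \<tau> \<le> F a"
  proof (rule DERIV_nonpos_imp_decreasing_open[where f = F and a = a and b = \<tau>])
    fix t assume t: "a < t" "t < \<tau>"
    then have "t \<in> {a..b}" "a < t" "t < b" using \<tau> by auto
    then show "\<exists>y. DERIV F t :> y \<and> y \<le> 0"
      using F[of t] neg[of t] by (metis at_within_Icc_at)
  next
    have "continuous_on {a..b} F" using F by (rule DERIV_continuous_on)
    then show "continuous_on {a..\<tau>} F" by (rule continuous_on_subset) (use \<tau> in auto)
  qed (use \<tau> in auto)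
  also have "F a = E a" by (simp add: F_def)
  finally have "exp (- c * (\<tau> - a)) * E \<tau> \<le> E a + integral {a..\<tau>} \<rho>" by (simp add: F_def)
  also have "integral {a..\<tau>} \<rho> \<le> integral {a..b} \<rho>"
    using \<tau> \<rho> by (intro integral_subset_le integrable_continuous_interval)
      (auto intro: continuous_on_subset)
  finally have "exp (c * (\<tau> - a)) * (exp (- c * (\<tau> - a)) * E \<tau>) \<le>
      exp (c * (\<tau> - a)) * (E a + integral {a..b} \<rho>)" by simp
  then show ?thesis by (simp add: mult.assoc[symmetric] exp_add[symmetric])
qed

text \<open>The Cauchy-Schwarz inequality, over the cube, over the directions and in time.\<close>
lemma time_integral_jump_le:
  fixes \<sigma> :: "'d \<Rightarrow> real ^ 'd \<Rightarrow> real \<Rightarrow> real"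
  assumes \<sigma>: "\<And>k. C0_upto s (\<sigma> k)" and ab: "0 \<le> a" "a \<le> b" "b \<le> s"
  shows "integral {a..b} (\<lambda>t. \<Sum>k\<in>UNIV. integral (cbox 0 1) (\<lambda>x. \<bar>\<sigma> k x t\<bar>)) \<le>
    sqrt (b - a) * sqrt (real CARD('d)) *
    sqrt (integral {a..b} (\<lambda>t. \<Sum>k\<in>UNIV. integral (cbox 0 1) (\<lambda>x. (\<sigma> k x t)\<^sup>2)))"
proof -
  let ?d = "real CARD('d)"
  define J where "J t = (\<Sum>k\<in>UNIV. integral (cbox 0 1) (\<lambda>x. \<bar>\<sigma> k x t\<bar>))" for t
  define S where "S t = (\<Sum>k\<in>UNIV. integral (cbox 0 1) (\<lambda>x. (\<sigma> k x t)\<^sup>2))" for t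
  have J0: "continuous_on {0..s} J" and S0: "continuous_on {0..s} S"
    unfolding J_def S_def
    by (auto intro!: continuous_on_sum continuous_on_integral_cube C0_upto_abs C0_upto_power \<sigma>)
  have sub: "{a..b} \<subseteq> {0..s}" using ab by auto
  have J: "continuous_on {a..b} J" and S: "continuous_on {a..b} S"
    using continuous_on_subset[OF J0 sub] continuous_on_subset[OF S0 sub] by auto
  have JS: "(J t)\<^sup>2 \<le> ?d * S t" if t: "t \<in> {a..b}" for t
  proof -
    have "(J t)\<^sup>2 \<le> (\<Sum>k\<in>UNIV. (integral (cbox 0 1) (\<lambda>x. \<bar>\<sigma> k x t\<bar>))\<^sup>2) * ?d"
      unfolding J_def by (rule sum_squared_le_sum_of_squares)
    also have "\<dots> \<le> S t * ?d"
      unfolding S_def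
    proof (intro mult_right_mono sum_mono)
      fix k
      have "continuous_on (cbox 0 1) (\<lambda>x. \<bar>\<sigma> k x t\<bar>)"
        using t sub by (intro C0_upto_slice[OF C0_upto_abs[OF \<sigma>]]) auto
      from square_integral_le[OF this]
      show "(integral (cbox 0 1) (\<lambda>x. \<bar>\<sigma> k x t\<bar>))\<^sup>2 \<le> integral (cbox 0 1) (\<lambda>x. (\<sigma> k x t)\<^sup>2)"
        by (simp add: content_unit_cbox)
    qed simp
    finally show ?thesis by (simp add: mult.commute)
  qed
  have "(integral {a..b} J)\<^sup>2 \<le> (b - a) * integral {a..b} (\<lambda>t. (J t)\<^sup>2)"
    using square_integral_le[of a b J] J ab by simp
  also have "\<dots> \<le> (b - a) * integral {a..b} (\<lambda>t. ?d * S t)"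
    using ab JS by (intro mult_left_mono integral_le integrable_continuous_interval continuous_intros J S) auto
  finally have "(integral {a..b} J)\<^sup>2 \<le> (b - a) * ?d * integral {a..b} S" by simp
  then have "integral {a..b} J \<le> sqrt ((b - a) * ?d * integral {a..b} S)"
    by (rule real_le_rsqrt)
  then show ?thesis unfolding J_def S_def by (simp add: real_sqrt_mult)
qed

section \<open>The energy estimate on one block\<close>

context wave_error
begin

lemma energy_eq_sum: "t \<in> {0..s} \<Longrightarrow> energy t = integral (cbox 0 1) (\<lambda>x. (w x t)\<^sup>2)
   + (\<Sum>k\<in>UNIV. integral (cbox 0 1) (\<lambda>x. (w1 k x t)\<^sup>2)) + integral (cbox 0 1) (\<lambda>x. (p x t)\<^sup>2)"
proof -
  assume t: "t \<in> {0..s}"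
  have *: "C0_upto s (\<lambda>x t. (w x t)\<^sup>2)" "C0_upto s (\<lambda>x t. (w1 k x t)\<^sup>2)" "C0_upto s (\<lambda>x t. (p x t)\<^sup>2)"
    "C0_upto s (\<lambda>x t. (w x t)\<^sup>2 + (\<Sum>k\<in>UNIV. (w1 k x t)\<^sup>2))" "C0_upto s (\<lambda>x t. \<Sum>k\<in>UNIV. (w1 k x t)\<^sup>2)" for k
    by (intro C0_upto_intros C0)+
  note i = *[THEN integrable_C0, OF t]
  show ?thesis
    unfolding energy_def
    by (subst integral_add[OF i(4) i(3)], subst integral_add[OF i(1) i(5)])
      (simp add: integral_sum i(2))
qed

lemma energy_nonneg: "0 \<le> energy t"
proof (cases "(\<lambda>x. (w x t)\<^sup>2 + (\<Sum>k\<in>UNIV. (w1 k x t)\<^sup>2) + (p x t)\<^sup>2) integrable_on cbox 0 1")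
  case True
  then show ?thesis unfolding energy_def by (rule integral_nonneg) (auto intro!: add_nonneg_nonneg sum_nonneg)
qed (simp add: energy_def not_integrable_integral)

lemma energy_deriv:
  assumes t: "t \<in> {0..s}"
  obtains E' where "(energy has_real_derivative E') (at t within {0..s})"
    and "E' \<le> 2 * energy t + residual t + 2 * boundary_flux t"
proof
  define B where "B k = integral (cbox 0 1) (\<lambda>x. p (set_coord k 1 x) t * w1 k (set_coord k 1 x) t
         - p (set_coord k 0 x) t * w1 k (set_coord k 0 x) t)" for k
  define E' where "E' = integral (cbox 0 1) (\<lambda>x. 2 * (w x t * z x t))
    + (\<Sum>k\<in>UNIV. 2 * (B k + integral (cbox 0 1) (\<lambda>x. q1 k x t * w1 k x t - p x t * w2 k x t)))
    + integral (cbox 0 1) (\<lambda>x. 2 * (p x t * p' x t))"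
  have sq: "((\<lambda>t. integral (cbox 0 1) (\<lambda>x. (y x t)\<^sup>2)) has_real_derivative
      integral (cbox 0 1) (\<lambda>x. 2 * (y x t * y' x t))) (at t within {0..s})"
    if "has_partial_t s y y'" "C0_upto s y" "C0_upto s y'" for y y' :: "real ^ 'd \<Rightarrow> real \<Rightarrow> real"
    using that t
    by (intro has_real_derivative_integral C0_upto_intros)
      (auto simp: has_partial_t_def intro!: derivative_eq_intros C0_upto_slice C0_upto_power)
  have "((\<lambda>t. integral (cbox 0 1) (\<lambda>x. (w x t)\<^sup>2)
      + (\<Sum>k\<in>UNIV. integral (cbox 0 1) (\<lambda>x. (w1 k x t)\<^sup>2)) + integral (cbox 0 1) (\<lambda>x. (p x t)\<^sup>2))
      has_real_derivative E') (at t within {0..s})"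
    unfolding E'_def B_def
    by (intro DERIV_add DERIV_sum sq deriv_grad_energy w_t p_t C0 t)
  then show "(energy has_real_derivative E') (at t within {0..s})"
    unfolding has_field_derivative_def
    by (rule has_derivative_transform[rotated 2]) (use t energy_eq_sum in auto)
  have wz: "C0_upto s (\<lambda>x t. 2 * (w x t * z x t))" and pp: "C0_upto s (\<lambda>x t. 2 * (p x t * p' x t))"
    and qw: "C0_upto s (\<lambda>x t. 2 * (q1 k x t * w1 k x t - p x t * w2 k x t))" 
    and qws: "C0_upto s (\<lambda>x t. \<Sum>k\<in>UNIV. 2 * (q1 k x t * w1 k x t - p x t * w2 k x t))" for k
    by (intro C0_upto_intros C0)+
  note i = wz[THEN integrable_C0, OF t] pp[THEN integrable_C0, OF t] qw[THEN integrable_C0, OF t]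
    qws[THEN integrable_C0, OF t]
  have e: "(\<lambda>x. 2 * ((w x t)\<^sup>2 + (\<Sum>k\<in>UNIV. (w1 k x t)\<^sup>2) + (p x t)\<^sup>2)) integrable_on cbox 0 1"
    and r: "(\<lambda>x. (q x t)\<^sup>2 + (p' x t - (\<Sum>k\<in>UNIV. w2 k x t))\<^sup>2 + (\<Sum>k\<in>UNIV. (q1 k x t)\<^sup>2))
      integrable_on cbox 0 1"
    by (intro integrable_C0[OF _ t] C0_upto_intros C0)+
  have "E' = 2 * boundary_flux t + (integral (cbox 0 1) (\<lambda>x. 2 * (w x t * z x t))
     + (\<Sum>k\<in>UNIV. integral (cbox 0 1) (\<lambda>x. 2 * (q1 k x t * w1 k x t - p x t * w2 k x t)))
     + integral (cbox 0 1) (\<lambda>x. 2 * (p x t * p' x t)))"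
    unfolding integral_mult_right
    by (simp only: E'_def boundary_flux_def B_def distrib_left sum.distrib sum_distrib_left
        integral_mult_right ac_simps)
  also have "(\<Sum>k\<in>UNIV. integral (cbox 0 1) (\<lambda>x. 2 * (q1 k x t * w1 k x t - p x t * w2 k x t))) =
    integral (cbox 0 1) (\<lambda>x. \<Sum>k\<in>UNIV. 2 * (q1 k x t * w1 k x t - p x t * w2 k x t))"
    by (rule integral_sum[symmetric]) (use i(3) in auto)
  also have "integral (cbox 0 1) (\<lambda>x. 2 * (w x t * z x t))
     + integral (cbox 0 1) (\<lambda>x. \<Sum>k\<in>UNIV. 2 * (q1 k x t * w1 k x t - p x t * w2 k x t))
     + integral (cbox 0 1) (\<lambda>x. 2 * (p x t * p' x t)) =
     integral (cbox 0 1) (\<lambda>x. 2 * (w x t * z x t)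
     + (\<Sum>k\<in>UNIV. 2 * (q1 k x t * w1 k x t - p x t * w2 k x t)) + 2 * (p x t * p' x t))"
    by (simp only: integral_add[OF integrable_add[OF i(1) i(4)] i(2)] integral_add[OF i(1) i(4)])
  finally have E': "E' = 2 * boundary_flux t + integral (cbox 0 1) (\<lambda>x. 2 * (w x t * z x t)
     + (\<Sum>k\<in>UNIV. 2 * (q1 k x t * w1 k x t - p x t * w2 k x t)) + 2 * (p x t * p' x t))" .
  have "integral (cbox 0 1) (\<lambda>x. 2 * (w x t * z x t)
     + (\<Sum>k\<in>UNIV. 2 * (q1 k x t * w1 k x t - p x t * w2 k x t)) + 2 * (p x t * p' x t))
    \<le> integral (cbox 0 1) (\<lambda>x. 2 * ((w x t)\<^sup>2 + (\<Sum>k\<in>UNIV. (w1 k x t)\<^sup>2) + (p x t)\<^sup>2)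
     + ((q x t)\<^sup>2 + (p' x t - (\<Sum>k\<in>UNIV. w2 k x t))\<^sup>2 + (\<Sum>k\<in>UNIV. (q1 k x t)\<^sup>2)))"
  proof (rule integral_le)
    fix x :: "real ^ 'd" assume x: "x \<in> cbox 0 1"
    define r where "r = p' x t - (\<Sum>k\<in>UNIV. w2 k x t)"
    have young: "2 * (a * b) \<le> a\<^sup>2 + b\<^sup>2" for a b :: real
      using sum_squares_bound[of a b] by simp
    have "(\<Sum>k\<in>UNIV. 2 * (q1 k x t * w1 k x t)) \<le> (\<Sum>k\<in>UNIV. (q1 k x t)\<^sup>2 + (w1 k x t)\<^sup>2)"
      by (intro sum_mono young)
    moreover have "0 \<le> (\<Sum>k\<in>UNIV. (w1 k x t)\<^sup>2)" by (intro sum_nonneg) auto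
    moreover note young[of "w x t" "p x t"] young[of "w x t" "q x t"] young[of "p x t" r]
    moreover have "2 * (w x t * z x t) + (\<Sum>k\<in>UNIV. 2 * (q1 k x t * w1 k x t - p x t * w2 k x t))
        + 2 * (p x t * p' x t) = 2 * (w x t * p x t) + 2 * (w x t * q x t) + 2 * (p x t * r)
        + (\<Sum>k\<in>UNIV. 2 * (q1 k x t * w1 k x t))"
      by (simp add: r_def z[OF x t] right_diff_distrib distrib_left sum_subtractf sum_distrib_left)
    ultimately show "2 * (w x t * z x t) + (\<Sum>k\<in>UNIV. 2 * (q1 k x t * w1 k x t - p x t * w2 k x t))
        + 2 * (p x t * p' x t) \<le> 2 * ((w x t)\<^sup>2 + (\<Sum>k\<in>UNIV. (w1 k x t)\<^sup>2) + (p x t)\<^sup>2)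
        + ((q x t)\<^sup>2 + (p' x t - (\<Sum>k\<in>UNIV. w2 k x t))\<^sup>2 + (\<Sum>k\<in>UNIV. (q1 k x t)\<^sup>2))"
      unfolding r_def[symmetric] by (simp add: sum.distrib)
  qed (rule integrable_add[OF integrable_add[OF i(1) i(4)] i(2)], rule integrable_add[OF e r])
  also have "\<dots> = integral (cbox 0 1) (\<lambda>x. 2 * ((w x t)\<^sup>2 + (\<Sum>k\<in>UNIV. (w1 k x t)\<^sup>2) + (p x t)\<^sup>2)) + residual t"
    unfolding residual_def by (rule integral_add[OF e r])
  also have "\<dots> = 2 * energy t + residual t"
    by (simp only: energy_def integral_mult_right)
  finally show "E' \<le> 2 * energy t + residual t + 2 * boundary_flux t" using E' by simp
qed

text \<open>
  The jumps \<open>\<sigma>1\<close> and \<open>\<sigma>2\<close> of p and of the normal derivative of w between opposite faces control the flux.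
  The constants M1 and M2 bound the other factor in each term of the discrete product rule.
\<close>
lemma energy_bound:
  fixes M1 M2 :: real
  defines "\<sigma>1 \<equiv> \<lambda>k x t. p (set_coord k 1 x) t - p (set_coord k 0 x) t"
    and "\<sigma>2 \<equiv> \<lambda>k x t. w1 k (set_coord k 1 x) t - w1 k (set_coord k 0 x) t"
  assumes ab: "0 \<le> a" "a \<le> b" "b \<le> s"
    and M1: "\<And>k x t. x \<in> cbox 0 1 \<Longrightarrow> t \<in> {0..s} \<Longrightarrow> \<bar>w1 k (set_coord k 1 x) t\<bar> \<le> M1"
    and M2: "\<And>k x t. x \<in> cbox 0 1 \<Longrightarrow> t \<in> {0..s} \<Longrightarrow> \<bar>p (set_coord k 0 x) t\<bar> \<le> M2"
    and \<tau>: "\<tau> \<in> {a..b}"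
  shows "energy \<tau> \<le> exp (2 * (b - a)) * (energy a + integral {a..b} residual
    + 2 * M1 * (sqrt (b - a) * sqrt (real CARD('d)) *
        sqrt (integral {a..b} (\<lambda>t. \<Sum>k\<in>UNIV. integral (cbox 0 1) (\<lambda>x. (\<sigma>1 k x t)\<^sup>2))))
    + 2 * M2 * (sqrt (b - a) * sqrt (real CARD('d)) *
        sqrt (integral {a..b} (\<lambda>t. \<Sum>k\<in>UNIV. integral (cbox 0 1) (\<lambda>x. (\<sigma>2 k x t)\<^sup>2)))))"
proof -
  define J1 where "J1 t = (\<Sum>k\<in>UNIV. integral (cbox 0 1) (\<lambda>x. \<bar>\<sigma>1 k x t\<bar>))" for t
  define J2 where "J2 t = (\<Sum>k\<in>UNIV. integral (cbox 0 1) (\<lambda>x. \<bar>\<sigma>2 k x t\<bar>))" for t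
  have M1_nonneg: "0 \<le> M1" and M2_nonneg: "0 \<le> M2"
    using M1[of 0 0] M2[of 0 0] s abs_ge_zero by (force simp: mem_box_cart intro: order_trans)+
  have \<sigma>: "C0_upto s (\<sigma>1 k)" "C0_upto s (\<sigma>2 k)" for k
    unfolding \<sigma>1_def \<sigma>2_def by (intro C0_upto_intros C0; simp)+
  have sub: "{a..b} \<subseteq> {0..s}" using ab by auto
  have cJ: "continuous_on {a..b} J1" "continuous_on {a..b} J2"
    unfolding J1_def J2_def
    by (rule continuous_on_subset[OF _ sub],
       intro continuous_on_sum continuous_on_integral_cube C0_upto_abs \<sigma>)+
  have J_nonneg: "0 \<le> J1 t" "0 \<le> J2 t" if t: "t \<in> {a..b}" for t
    unfolding J1_def J2_def
    by (intro sum_nonneg integral_nonneg integrable_C0 C0_upto_abs \<sigma>; use t sub in auto)+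
  have R: "C0_upto s (\<lambda>x t. (q x t)\<^sup>2 + (p' x t - (\<Sum>k\<in>UNIV. w2 k x t))\<^sup>2 + (\<Sum>k\<in>UNIV. (q1 k x t)\<^sup>2))"
    by (intro C0_upto_intros C0)
  have cR: "continuous_on {a..b} residual"
    unfolding residual_def by (rule continuous_on_subset[OF continuous_on_integral_cube[OF R] sub])
  have R_nonneg: "0 \<le> residual t" if t: "t \<in> {a..b}" for t
    unfolding residual_def
    by (intro integral_nonneg integrable_C0 R) (use t sub in \<open>auto intro!: add_nonneg_nonneg sum_nonneg\<close>)
  have flux: "boundary_flux t \<le> M1 * J1 t + M2 * J2 t" if t: "t \<in> {a..b}" for t
  proof -
    have t': "t \<in> {0..s}" using t sub by auto
    have "boundary_flux t \<le> (\<Sum>k\<in>UNIV. integral (cbox 0 1) (\<lambda>x. M1 * \<bar>\<sigma>1 k x t\<bar> + M2 * \<bar>\<sigma>2 k x t\<bar>))"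
      unfolding boundary_flux_def
    proof (intro sum_mono integral_le)
      fix k and x :: "real ^ 'd" assume x: "x \<in> cbox 0 1"
      have "p (set_coord k 1 x) t * w1 k (set_coord k 1 x) t - p (set_coord k 0 x) t * w1 k (set_coord k 0 x) t
          = \<sigma>1 k x t * w1 k (set_coord k 1 x) t + \<sigma>2 k x t * p (set_coord k 0 x) t"
        by (simp add: \<sigma>1_def \<sigma>2_def algebra_simps)
      also have "\<dots> \<le> \<bar>\<sigma>1 k x t\<bar> * \<bar>w1 k (set_coord k 1 x) t\<bar> + \<bar>\<sigma>2 k x t\<bar> * \<bar>p (set_coord k 0 x) t\<bar>"
        unfolding abs_mult[symmetric] by (intro add_mono abs_ge_self)
      also have "\<dots> \<le> \<bar>\<sigma>1 k x t\<bar> * M1 + \<bar>\<sigma>2 k x t\<bar> * M2"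
        by (intro add_mono mult_left_mono M1 M2 x t') auto
      finally show "p (set_coord k 1 x) t * w1 k (set_coord k 1 x) t - p (set_coord k 0 x) t * w1 k (set_coord k 0 x) t
          \<le> M1 * \<bar>\<sigma>1 k x t\<bar> + M2 * \<bar>\<sigma>2 k x t\<bar>" by (simp add: mult.commute)
    qed (intro integrable_C0[OF _ t'] C0_upto_intros C0 \<sigma>; simp)+
    also have "\<dots> = M1 * J1 t + M2 * J2 t"
      unfolding J1_def J2_def sum_distrib_left sum.distrib[symmetric]
    proof (intro sum.cong refl)
      fix k
      have "(\<lambda>x. M1 * \<bar>\<sigma>1 k x t\<bar>) integrable_on cbox 0 1" "(\<lambda>x. M2 * \<bar>\<sigma>2 k x t\<bar>) integrable_on cbox 0 1"
        by (intro integrable_C0[OF _ t'] C0_upto_intros \<sigma>)+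
      from integral_add[OF this]
      show "integral (cbox 0 1) (\<lambda>x. M1 * \<bar>\<sigma>1 k x t\<bar> + M2 * \<bar>\<sigma>2 k x t\<bar>) =
        M1 * integral (cbox 0 1) (\<lambda>x. \<bar>\<sigma>1 k x t\<bar>) + M2 * integral (cbox 0 1) (\<lambda>x. \<bar>\<sigma>2 k x t\<bar>)" by simp
    qed
    finally show ?thesis .
  qed
  define \<rho> where "\<rho> t = residual t + (2 * M1 * J1 t + 2 * M2 * J2 t)" for t
  have c\<rho>: "continuous_on {a..b} \<rho>" unfolding \<rho>_def by (intro continuous_intros cR cJ)
  have \<rho>_nonneg: "0 \<le> \<rho> t" if "t \<in> {a..b}" for t
    using that M1_nonneg M2_nonneg J_nonneg R_nonneg by (simp add: \<rho>_def)
  have "\<exists>E'. (energy has_real_derivative E') (at t within {a..b}) \<and> E' \<le> 2 * energy t + \<rho> t"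
    if t: "t \<in> {a..b}" for t
  proof -
    have "t \<in> {0..s}" using t sub by auto
    then obtain E' where "(energy has_real_derivative E') (at t within {0..s})"
      "E' \<le> 2 * energy t + residual t + 2 * boundary_flux t"
      by (rule energy_deriv)
    then show ?thesis using flux[OF t] DERIV_subset[OF _ sub]
      by (intro exI[of _ E']) (auto simp: \<rho>_def)
  qed
  then obtain E' where E': "\<And>t. t \<in> {a..b} \<Longrightarrow> (energy has_real_derivative E' t) (at t within {a..b})"
    "\<And>t. t \<in> {a..b} \<Longrightarrow> E' t \<le> 2 * energy t + \<rho> t" by metis
  have "energy \<tau> \<le> exp (2 * (\<tau> - a)) * (energy a + integral {a..b} \<rho>)"
    by (rule gronwall[OF E' c\<rho> \<rho>_nonneg _ \<tau>]) auto
  also have "\<dots> \<le> exp (2 * (b - a)) * (energy a + integral {a..b} \<rho>)"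
    using \<tau> by (intro mult_right_mono add_nonneg_nonneg integral_nonneg energy_nonneg \<rho>_nonneg
      integrable_continuous_interval c\<rho>) auto
  finally have le: "energy \<tau> \<le> exp (2 * (b - a)) * (energy a + integral {a..b} \<rho>)" .
  have i: "(\<lambda>t. 2 * M1 * J1 t) integrable_on {a..b}" "(\<lambda>t. 2 * M2 * J2 t) integrable_on {a..b}"
    by (intro integrable_continuous_interval continuous_intros cJ)+
  have "integral {a..b} \<rho> = integral {a..b} residual
      + (integral {a..b} (\<lambda>t. 2 * M1 * J1 t) + integral {a..b} (\<lambda>t. 2 * M2 * J2 t))"
    unfolding \<rho>_def
    by (simp only: integral_add[OF integrable_continuous_interval[OF cR] integrable_add[OF i]]
        integral_add[OF i])
  also have "\<dots> = integral {a..b} residual + 2 * M1 * integral {a..b} J1 + 2 * M2 * integral {a..b} J2"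
    by simp
  finally have \<rho>: "integral {a..b} \<rho> =
    integral {a..b} residual + 2 * M1 * integral {a..b} J1 + 2 * M2 * integral {a..b} J2" .
  have "2 * M1 * integral {a..b} J1 \<le> 2 * M1 * (sqrt (b - a) * sqrt (real CARD('d)) *
        sqrt (integral {a..b} (\<lambda>t. \<Sum>k\<in>UNIV. integral (cbox 0 1) (\<lambda>x. (\<sigma>1 k x t)\<^sup>2))))"
    unfolding J1_def using M1_nonneg
    by (intro mult_left_mono time_integral_jump_le[where s = s] \<sigma> ab) auto
  moreover have "2 * M2 * integral {a..b} J2 \<le> 2 * M2 * (sqrt (b - a) * sqrt (real CARD('d)) *
        sqrt (integral {a..b} (\<lambda>t. \<Sum>k\<in>UNIV. integral (cbox 0 1) (\<lambda>x. (\<sigma>2 k x t)\<^sup>2))))"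
    unfolding J2_def using M2_nonneg
    by (intro mult_left_mono time_integral_jump_le[where s = s] \<sigma> ab) auto
  ultimately show ?thesis
    by (intro order_trans[OF le] mult_left_mono) (simp_all add: \<rho>)
qed

end

section \<open>Smoothness of networks\<close>

text \<open>
  Functions with n continuous derivatives on the whole space. Continuity and further
  differentiability of the derivative are required along each direction h separately: this keeps
  the functions real-valued, so that the definition can recurse.
\<close>
primrec Ck :: "nat \<Rightarrow> ('a::real_normed_vector \<Rightarrow> real) \<Rightarrow> bool" where
  "Ck 0 F \<longleftrightarrow> continuous_on UNIV F"
| "Ck (Suc n) F \<longleftrightarrow>
     (\<exists>F'. (\<forall>x. (F has_derivative F' x) (at x)) \<and> (\<forall>h. Ck n (\<lambda>x. F' x h)))"

lemma Ck_SucD: "Ck (Suc n) F \<Longrightarrow> Ck n F"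
proof (induction n arbitrary: F)
  case 0
  then show ?case
    by (auto intro!: continuous_at_imp_continuous_on dest: has_derivative_continuous)
next
  case (Suc n)
  then obtain F' where "\<And>x. (F has_derivative F' x) (at x)" "\<And>h. Ck (Suc n) (\<lambda>x. F' x h)"
    by (subst (asm) Ck.simps(2)) blast
  then show ?case using Suc.IH by (subst Ck.simps(2)) blast
qed

lemma Ck_continuous: "Ck n F \<Longrightarrow> continuous_on UNIV F"
  by (induction n) (simp, metis Ck_SucD)

lemma Ck_const: "Ck n (\<lambda>x. c)"
proof (induction n arbitrary: c)
  case (Suc n)
  show ?case by (simp, rule exI[of _ "\<lambda>x h. 0"]) (auto simp: Suc)
qed simp

lemma Ck_bounded_linear: "bounded_linear F \<Longrightarrow> Ck n F"
  by (cases n) (auto simp: linear_continuous_on Ck_const bounded_linear_imp_has_derivative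
      intro!: exI[of _ "\<lambda>x. F"])

lemma Ck_add: "Ck n F \<Longrightarrow> Ck n G \<Longrightarrow> Ck n (\<lambda>x. F x + G x)"
proof (induction n arbitrary: F G)
  case (Suc n)
  from Suc.prems obtain F' G' where
    "\<And>x. (F has_derivative F' x) (at x)" "\<And>h. Ck n (\<lambda>x. F' x h)"
    "\<And>x. (G has_derivative G' x) (at x)" "\<And>h. Ck n (\<lambda>x. G' x h)" by auto
  then show ?case
    by (auto intro!: exI[of _ "\<lambda>x h. F' x h + G' x h"] has_derivative_add Suc.IH)
qed (auto intro: continuous_on_add)

lemma Ck_mult: "Ck n F \<Longrightarrow> Ck n G \<Longrightarrow> Ck n (\<lambda>x. F x * G x)"
proof (induction n arbitrary: F G)
  case (Suc n)
  from Suc.prems obtain F' G' where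
    "\<And>x. (F has_derivative F' x) (at x)" "\<And>h. Ck n (\<lambda>x. F' x h)"
    "\<And>x. (G has_derivative G' x) (at x)" "\<And>h. Ck n (\<lambda>x. G' x h)" by auto
  then show ?case
    using Ck_SucD[OF Suc.prems(1)] Ck_SucD[OF Suc.prems(2)]
    by (auto intro!: exI[of _ "\<lambda>x h. F x * G' x h + F' x h * G x"] has_derivative_mult
        Suc.IH Ck_add)
qed (auto intro: continuous_on_mult)

lemma Ck_sum: "(\<And>i. i \<in> I \<Longrightarrow> Ck n (F i)) \<Longrightarrow> Ck n (\<lambda>x. \<Sum>i\<in>I. F i x)"
  by (induction I rule: infinite_finite_induct) (auto simp: Ck_const intro!: Ck_add)

lemma smooth_function_deriv: "smooth_function g \<Longrightarrow> smooth_function (deriv g)"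
  unfolding smooth_function_def by (metis comp_apply funpow_Suc_right)

lemma smooth_function_DERIV: "smooth_function g \<Longrightarrow> DERIV g x :> deriv g x"
  unfolding smooth_function_def by (metis DERIV_deriv_iff_field_differentiable funpow_0)

lemma Ck_compose:
  "smooth_function g \<Longrightarrow> Ck n F \<Longrightarrow> Ck n (\<lambda>x. g (F x))"
proof (induction n arbitrary: g F)
  case 0
  have "continuous_on UNIV g"
    using smooth_function_DERIV[OF 0(1)] by (auto intro!: continuous_at_imp_continuous_on dest: DERIV_isCont)
  then show ?case using 0(2) by (auto intro: continuous_on_compose2)
next
  case (Suc n)
  from Suc.prems obtain F' where
    F': "\<And>x. (F has_derivative F' x) (at x)" "\<And>h. Ck n (\<lambda>x. F' x h)" by auto
  have "((\<lambda>x. g (F x)) has_derivative (\<lambda>h. F' x h * deriv g (F x))) (at x)" for x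
    using has_derivative_compose[OF F'(1) smooth_function_DERIV[OF Suc.prems(1), unfolded has_field_derivative_def]]
    by (simp add: mult.commute)
  moreover have "Ck n (\<lambda>x. F' x h * deriv g (F x))" for h
    by (rule Ck_mult[OF F'(2)
        Suc.IH[OF smooth_function_deriv[OF Suc.prems(1)] Ck_SucD[OF Suc.prems(2)]]])
  ultimately show ?case
    unfolding Ck.simps by (intro exI[of _ "\<lambda>x h. F' x h * deriv g (F x)"]) simp
qed

text \<open>The derivative of tanh is \<open>1 - tanh\<^sup>2\<close>, so all derivatives are polynomials in tanh.\<close>
lemma smooth_function_tanh: "smooth_function (tanh :: real \<Rightarrow> real)"
proof -
  have D: "DERIV (\<lambda>x. poly P (tanh x)) x :> poly (pderiv P * [:1, 0, -1:]) (tanh x)" for P and x :: real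
    by (auto intro!: derivative_eq_intros simp: power2_eq_square algebra_simps)
  have "\<exists>P. (deriv ^^ n) tanh = (\<lambda>x :: real. poly P (tanh x))" for n
  proof (induction n)
    case 0
    show ?case by (rule exI[of _ "[:0, 1:]"]) auto
  next
    case (Suc n)
    then obtain P where "(deriv ^^ n) tanh = (\<lambda>x :: real. poly P (tanh x))" by blast
    then have "(deriv ^^ Suc n) tanh = (\<lambda>x :: real. poly (pderiv P * [:1, 0, -1:]) (tanh x))"
      using DERIV_imp_deriv[OF D] by auto
    then show ?case by blast
  qed
  then show ?thesis
    unfolding smooth_function_def field_differentiable_def using D by metis
qed

lemma Ck_hidden_layer:
  assumes "hlconc_pinn a b \<theta>" and "m < depth \<theta>"
  shows "Ck n (\<lambda>p :: (real ^ 'd) \<times> real. hidden_layer \<theta> (space_time_input (fst p) (snd p)) m r)"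
  using assms(2)
proof (induction m arbitrary: r)
  case 0
  have "bounded_linear (\<lambda>p :: (real ^ 'd) \<times> real. space_time_input (fst p) (snd p) r)"
  proof (cases "r < CARD('d)")
    case True
    then show ?thesis
      by (simp add: space_time_input_def
        bounded_linear_compose[OF bounded_linear_vec_nth bounded_linear_fst])
  next
    case False
    then show ?thesis by (simp add: space_time_input_def bounded_linear_snd)
  qed
  then show ?case by (simp add: Ck_bounded_linear)
next
  case (Suc m)
  have "smooth_function (act \<theta> (Suc m))"
  proof -
    consider "Suc m = 1" | "Suc m = 2" | "Suc m \<in> {3..<depth \<theta>}" using Suc.prems by fastforce
    then show ?thesis
      using assms(1) smooth_function_tanh unfolding hlconc_pinn_def by cases metis+
  qed
  then show ?case
    unfolding hidden_layer.simps
    by (rule Ck_compose) (use Suc in \<open>intro Ck_add Ck_sum Ck_mult Ck_const; simp\<close>)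
qed

lemma Ck_net_function:
  assumes "hlconc_pinn a b \<theta>"
  shows "Ck n (\<lambda>p :: (real ^ 'd) \<times> real. net_function \<theta> (fst p) (snd p))"
proof -
  have "m < depth \<theta>" if "m \<in> {1..depth \<theta> - 1}" for m using that by auto
  then show ?thesis
    unfolding net_function_def net_output_def
    by (intro Ck_add Ck_sum Ck_mult Ck_const Ck_hidden_layer[OF assms])
qed

lemma has_partial_x_of_has_derivative:
  fixes F :: "(real ^ 'd) \<times> real \<Rightarrow> real"
  assumes "\<And>p. (F has_derivative F' p) (at p)"
  shows "has_partial_x k (\<lambda>x. F (x, t)) (\<lambda>x. F' (x, t) (axis k 1, 0))"
  unfolding has_partial_x_def
proof
  fix x :: "real ^ 'd"
  have eq: "set_coord k r x = x + (r - x $ k) *\<^sub>R axis k 1" for r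
    by (simp add: vec_eq_iff axis_def)
  have "((\<lambda>r. (set_coord k r x, t)) has_derivative (\<lambda>h. (h *\<^sub>R axis k 1, 0))) (at (x $ k) within {0..1})"
    unfolding eq by (auto intro!: derivative_eq_intros)
  from has_derivative_compose[OF this assms]
  have "((\<lambda>r. F (set_coord k r x, t)) has_derivative (\<lambda>h. F' (x, t) (h *\<^sub>R axis k 1, 0))) (at (x $ k) within {0..1})"
    by simp
  moreover have "F' (x, t) (h *\<^sub>R axis k 1, 0) = h * F' (x, t) (axis k 1, 0)" for h
    using linear_scale[OF has_derivative_linear[OF assms[of "(x, t)"]], of h "(axis k 1, 0)"] by simp
  ultimately show "((\<lambda>r. F (set_coord k r x, t)) has_real_derivative F' (x, t) (axis k 1, 0)) (at (x $ k) within {0..1})"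
    by (simp add: has_field_derivative_def mult_commute_abs)
qed

lemma has_partial_t_of_has_derivative:
  fixes F :: "(real ^ 'd) \<times> real \<Rightarrow> real"
  assumes "\<And>p. (F has_derivative F' p) (at p)"
  shows "has_partial_t s (\<lambda>x t. F (x, t)) (\<lambda>x t. F' (x, t) (0, 1))"
  unfolding has_partial_t_def
proof (intro ballI)
  fix x :: "real ^ 'd" and t
  have "((\<lambda>t. (x, t)) has_derivative (\<lambda>h. (0, h))) (at t within {0..s})"
    by (auto intro!: derivative_eq_intros)
  from has_derivative_compose[OF this assms]
  have "((\<lambda>t. F (x, t)) has_derivative (\<lambda>h. F' (x, t) (0, h))) (at t within {0..s})" .
  moreover have "(\<lambda>h. F' (x, t) (0, h)) = (*) (F' (x, t) (0, 1))"
  proof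
    fix h :: real
    show "F' (x, t) (0, h) = F' (x, t) (0, 1) * h"
      using linear_scale[OF has_derivative_linear[OF assms[of "(x, t)"]], of h "(0, 1)"]
      by (simp add: mult.commute)
  qed
  ultimately show "((\<lambda>t. F (x, t)) has_real_derivative F' (x, t) (0, 1)) (at t within {0..s})"
    by (simp only: has_field_derivative_def)
qed

lemma Ck_C0_upto: "Ck n F \<Longrightarrow> C0_upto s (\<lambda>x t. F (x, t))"
  using Ck_continuous[of n F] by (auto simp: C0_upto_def intro: continuous_on_subset)

text \<open>The derivatives of a network that the energy estimate uses. The end time s is arbitrary because
  networks are smooth on the whole space.\<close>
lemma net_function_regular:
  assumes "hlconc_pinn a b \<theta>"
  obtains Wt :: "real ^ 'd \<Rightarrow> real \<Rightarrow> real" and W1 W2 Wt1 :: "'d \<Rightarrow> real ^ 'd \<Rightarrow> real \<Rightarrow> real" where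
    "\<And>s. C0_upto s (net_function \<theta> :: real ^ 'd \<Rightarrow> real \<Rightarrow> real)" "\<And>s. C0_upto s Wt"
    "\<And>s k. C0_upto s (W1 k)" "\<And>s k. C0_upto s (W2 k)" "\<And>s k. C0_upto s (Wt1 k)"
    "\<And>s. has_partial_t s (net_function \<theta>) Wt"
    "\<And>k t. has_partial_x k (\<lambda>x. net_function \<theta> x t) (\<lambda>x. W1 k x t)"
    "\<And>k t. has_partial_x k (\<lambda>x. W1 k x t) (\<lambda>x. W2 k x t)"
    "\<And>k t. has_partial_x k (\<lambda>x. Wt x t) (\<lambda>x. Wt1 k x t)"
proof -
  define F where "F = (\<lambda>p :: (real ^ 'd) \<times> real. net_function \<theta> (fst p) (snd p))"
  have F: "Ck n F" for n unfolding F_def by (rule Ck_net_function[OF assms])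
  from F[of "Suc (Suc 0)"] obtain F' where
    F': "\<And>p. (F has_derivative F' p) (at p)" "\<And>h. Ck (Suc 0) (\<lambda>p. F' p h)"
    by (subst (asm) Ck.simps(2)) blast
  then have "\<forall>h. \<exists>G. (\<forall>p. ((\<lambda>p. F' p h) has_derivative G p) (at p)) \<and> (\<forall>h'. Ck 0 (\<lambda>p. G p h'))"
    by (subst (asm) Ck.simps(2)) blast
  then obtain F'' where
    F'': "\<And>h p. ((\<lambda>p. F' p h) has_derivative F'' h p) (at p)" "\<And>h h'. Ck 0 (\<lambda>p. F'' h p h')"
    by metis
  have eq: "net_function \<theta> = (\<lambda>x t. F (x, t))" by (simp add: F_def)
  show ?thesis
  proof (rule that)
    show "\<And>s. C0_upto s (net_function \<theta> :: real ^ 'd \<Rightarrow> real \<Rightarrow> real)"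
      unfolding eq by (rule Ck_C0_upto[OF F])
    show "\<And>s. C0_upto s (\<lambda>x t. F' (x, t) (0, 1))" "\<And>s k. C0_upto s (\<lambda>x t. F' (x, t) (axis k 1, 0))"
      by (rule Ck_C0_upto[OF F'(2)])+
    show "\<And>s k. C0_upto s (\<lambda>x t. F'' (axis k 1, 0) (x, t) (axis k 1, 0))"
      "\<And>s k. C0_upto s (\<lambda>x t. F'' (0, 1) (x, t) (axis k 1, 0))"
      by (rule Ck_C0_upto[OF F''(2)])+
    show "\<And>s. has_partial_t s (net_function \<theta>) (\<lambda>x t. F' (x, t) (0, 1))"
      unfolding eq by (rule has_partial_t_of_has_derivative[OF F'(1)])
    show "\<And>k t. has_partial_x k (\<lambda>x. net_function \<theta> x t) (\<lambda>x. F' (x, t) (axis k 1, 0))"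
      unfolding eq by (rule has_partial_x_of_has_derivative[OF F'(1)])
    show "\<And>k t. has_partial_x k (\<lambda>x. F' (x, t) (axis k 1, 0)) (\<lambda>x. F'' (axis k 1, 0) (x, t) (axis k 1, 0))"
      "\<And>k t. has_partial_x k (\<lambda>x. F' (x, t) (0, 1)) (\<lambda>x. F'' (0, 1) (x, t) (axis k 1, 0))"
      by (rule has_partial_x_of_has_derivative[OF F''(1)])+
  qed
qed

section \<open>Partial derivatives, boundary norms and surface integrals\<close>

lemma real_derivative_within_unique:
  fixes f :: "real \<Rightarrow> real"
  assumes "a < b" "t \<in> {a..b}"
    "(f has_real_derivative D) (at t within {a..b})" "(f has_real_derivative D') (at t within {a..b})"
  shows "D = D'"
  using assms vector_derivative_within_cbox[of a b t f]
  by (metis cbox_interval has_real_derivative_iff_has_vector_derivative)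

lemma partial_x_eq:
  assumes "has_partial_x k g g'" "x \<in> cbox 0 1"
  shows "partial_x k g x = g' x"
  using assms vector_derivative_within_cbox[of 0 1 "x $ k" "\<lambda>r. g (set_coord k r x)" "g' x"]
  by (auto simp: partial_x_def has_partial_x_def has_real_derivative_iff_has_vector_derivative mem_box_cart)

lemma has_partial_x_partial_x:
  assumes "\<And>x. x \<in> cbox 0 1 \<Longrightarrow> differentiable_x k g x"
  shows "has_partial_x k g (partial_x k g)"
  using assms
  by (auto simp: has_partial_x_def differentiable_x_def partial_x_def
      has_real_derivative_iff_has_vector_derivative vector_derivative_works[symmetric])

lemma differentiable_x_of_has_partial_x:
  assumes "has_partial_x k g g'" "x \<in> cbox 0 1"
  shows "differentiable_x k g x"
  using assms by (auto simp: has_partial_x_def differentiable_x_def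
      has_real_derivative_iff_has_vector_derivative intro: differentiableI_vector)

lemma partial_t_eq:
  assumes "has_partial_t s w w'" "0 < s" "x \<in> cbox 0 1" "t \<in> {0..s}"
  shows "partial_t s w x t = w' x t"
  using assms vector_derivative_within_cbox[of 0 s t "w x" "w' x t"]
  by (auto simp: partial_t_def has_partial_t_def has_real_derivative_iff_has_vector_derivative)

lemma has_partial_t_partial_t:
  assumes "\<And>x t. x \<in> cbox 0 1 \<Longrightarrow> t \<in> {0..s} \<Longrightarrow> differentiable_t s w x t"
  shows "has_partial_t s w (partial_t s w)"
  using assms
  by (auto simp: has_partial_t_def differentiable_t_def partial_t_def
      has_real_derivative_iff_has_vector_derivative vector_derivative_works[symmetric])

lemma differentiable_t_of_has_partial_t:
  assumes "has_partial_t s w w'" "x \<in> cbox 0 1" "t \<in> {0..s}"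
  shows "differentiable_t s w x t"
  unfolding differentiable_t_def
  by (rule differentiableI_vector[where y = "w' x t"])
    (use assms in \<open>auto simp: has_partial_t_def has_real_derivative_iff_has_vector_derivative\<close>)

lemma has_partial_t_mono:
  assumes "has_partial_t s w w'" "s' \<le> s"
  shows "has_partial_t s' w w'"
  using assms unfolding has_partial_t_def
  by (auto intro!: DERIV_subset[where t = "{0..s'}" and s = "{0..s}"])

lemma has_partial_x_cong:
  assumes "has_partial_x k g g'" "\<And>x. x \<in> cbox 0 1 \<Longrightarrow> h x = g x"
    and "\<And>x. x \<in> cbox 0 1 \<Longrightarrow> h' x = g' x"
  shows "has_partial_x k h h'"
  unfolding has_partial_x_def
proof
  fix x :: "real ^ 'a" assume x: "x \<in> cbox 0 1"
  then have k: "x $ k \<in> {0..1}" by (simp add: mem_box_cart)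
  have "((\<lambda>r. g (set_coord k r x)) has_real_derivative h' x) (at (x $ k) within {0..1})"
    using assms(1,3) x by (auto simp: has_partial_x_def)
  then show "((\<lambda>r. h (set_coord k r x)) has_real_derivative h' x) (at (x $ k) within {0..1})"
    unfolding has_field_derivative_def
    by (rule has_derivative_transform[OF k, rotated])
      (use assms(2) set_coord_in_cbox[OF x] in auto)
qed

lemma has_partial_t_cong:
  assumes "has_partial_t s g g'" "\<And>x t. x \<in> cbox 0 1 \<Longrightarrow> t \<in> {0..s} \<Longrightarrow> h' x t = g' x t"
  shows "has_partial_t s g h'"
  using assms by (simp add: has_partial_t_def)

lemma has_partial_x_diff:
  "has_partial_x k g g' \<Longrightarrow> has_partial_x k h h' \<Longrightarrow>
    has_partial_x k (\<lambda>x. g x - h x) (\<lambda>x. g' x - h' x)"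
  by (auto simp: has_partial_x_def intro: DERIV_diff)

lemma has_partial_t_diff:
  "has_partial_t s g g' \<Longrightarrow> has_partial_t s h h' \<Longrightarrow>
    has_partial_t s (\<lambda>x t. g x t - h x t) (\<lambda>x t. g' x t - h' x t)"
  by (auto simp: has_partial_t_def intro: DERIV_diff)

text \<open>The coordinates of a point of the half-open cell are less than 1, so the cell
  contains all points of the closed cube that are near such a point on the line in direction k.\<close>
lemma partial_x_eq_on_cell:
  assumes "has_partial_x k h h'" "\<And>x. x \<in> cell \<Longrightarrow> g x = h x" "x \<in> cell"
  shows "partial_x k g x = h' x"
proof -
  have x: "x \<in> cbox 0 1" and k: "x $ k \<in> {0..1}" "x $ k < 1"
    using assms(3) cell_sandwich(2) by (auto simp: cell_def less_imp_le)
  have ev: "\<forall>\<^sub>F r in nhds (x $ k). r < 1"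
    using eventually_nhds_in_open[of "{..<1}" "x $ k"] k(2) by simp
  have "\<forall>\<^sub>F r in nhds (x $ k). r \<in> {0..1} \<longrightarrow> g (set_coord k r x) = h (set_coord k r x)"
    using ev by eventually_elim (use assms(2,3) in \<open>auto simp: cell_def\<close>)
  then have "((\<lambda>r. g (set_coord k r x)) has_vector_derivative h' x) (at (x $ k) within {0..1}) \<longleftrightarrow>
      ((\<lambda>r. h (set_coord k r x)) has_vector_derivative h' x) (at (x $ k) within {0..1})"
    by (intro has_vector_derivative_cong_ev) (use assms(2,3) in auto)
  then have "((\<lambda>r. g (set_coord k r x)) has_vector_derivative h' x) (at (x $ k) within {0..1})"
    using assms(1) x by (simp add: has_partial_x_def has_real_derivative_iff_has_vector_derivative)
  then show ?thesis
    using vector_derivative_within_cbox[of 0 1 "x $ k" "\<lambda>r. g (set_coord k r x)" "h' x"] k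
    by (simp add: partial_x_def)
qed

lemma C0_upto_mono: "C0_upto s w \<Longrightarrow> s' \<le> s \<Longrightarrow> C0_upto s' w"
  unfolding C0_upto_def by (rule continuous_on_subset) auto

lemma C0_upto_cong:
  assumes "C0_upto s w" "\<And>x t. x \<in> cbox 0 1 \<Longrightarrow> t \<in> {0..s} \<Longrightarrow> y x t = w x t"
  shows "C0_upto s y"
proof -
  have "continuous_on (closed_cell \<times> {0..s}) (\<lambda>(x, t). y x t) \<longleftrightarrow>
      continuous_on (closed_cell \<times> {0..s}) (\<lambda>(x, t). w x t)"
    by (rule continuous_on_cong) (use assms(2) in \<open>auto simp: closed_cell_eq\<close>)
  then show ?thesis using assms(1) by (simp add: C0_upto_def)
qed

lemma C0_upto_eq_on_closed_cell:
  assumes "C0_upto s g" "C0_upto s h" "\<And>x t. x \<in> cell \<Longrightarrow> t \<in> {0..s} \<Longrightarrow> g x t = h x t"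
    and "x \<in> cbox 0 1" "t \<in> {0..s}"
  shows "g x t = h x t"
proof -
  have "continuous_on (closure cell) (\<lambda>x. g x t - h x t)"
    unfolding closed_cell_eq by (intro continuous_on_diff C0_upto_slice[OF assms(1,5)] C0_upto_slice[OF assms(2,5)])
  then have "g x t - h x t = 0"
    by (rule continuous_constant_on_closure) (use assms closed_cell_eq in auto)
  then show ?thesis by simp
qed

lemma set_coord_in_boundary:
  "x \<in> cbox 0 1 \<Longrightarrow> a \<in> {0, 1} \<Longrightarrow> set_coord k a x \<in> cell_boundary"
  unfolding cell_boundary_eq by (auto simp: mem_box_cart intro!: exI[of _ k])

lemma opposite_set_coord [simp]: "opposite k (set_coord k a x) = set_coord k (1 - a) x"
  by (simp add: opposite_def)

lemma sup_norm_bdry_upper: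
  assumes "C0_upto s w" "x \<in> cell_boundary" "t \<in> {0..s}"
  shows "\<bar>w x t\<bar> \<le> sup_norm_bdry s w"
proof -
  have "compact ((\<lambda>(x, t). \<bar>w x t\<bar>) ` (cbox 0 1 \<times> {0..s}))"
    using C0_upto_abs[OF assms(1)]
    by (intro compact_continuous_image compact_Times) (auto simp: C0_upto_def closed_cell_eq)
  then have "bdd_above ((\<lambda>(x, t). \<bar>w x t\<bar>) ` (cbox 0 1 \<times> {0..s}))"
    by (rule bounded_imp_bdd_above[OF compact_imp_bounded])
  then have "bdd_above ((\<lambda>(x, t). \<bar>w x t\<bar>) ` (cell_boundary \<times> {0..s}))"
    by (rule bdd_above_mono) (auto simp: cell_boundary_eq)
  from cSUP_upper[OF _ this, of "(x, t)"] show ?thesis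
    using assms(2,3) by (simp add: sup_norm_bdry_def)
qed

lemma partial_x_le_C1_norm_bdry:
  fixes w :: "real ^ 'd \<Rightarrow> real \<Rightarrow> real"
  assumes w: "C1_upto s w" and x: "x \<in> cell_boundary" "t \<in> {0..s}"
  shows "\<bar>partial_x k (\<lambda>y. w y t) x\<bar> \<le> C1_norm_bdry s w"
proof -
  have pos: "0 \<le> sup_norm_bdry s y" if "C0_upto s y" for y :: "real ^ 'd \<Rightarrow> real \<Rightarrow> real"
    using sup_norm_bdry_upper[OF that x] by linarith
  have C: "C0_upto s w" "C0_upto s (partial_t s w)" "\<And>k. C0_upto s (\<lambda>x t. partial_x k (\<lambda>y. w y t) x)"
    using w by (auto simp: C1_upto_def)
  have "\<bar>partial_x k (\<lambda>y. w y t) x\<bar> \<le> sup_norm_bdry s (\<lambda>x t. partial_x k (\<lambda>y. w y t) x)"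
    by (rule sup_norm_bdry_upper[OF C(3) x])
  also have "\<dots> \<le> (\<Sum>k\<in>UNIV. sup_norm_bdry s (\<lambda>x t. partial_x k (\<lambda>y. w y t) x))"
    by (rule member_le_sum) (use pos C in auto)
  also have "\<dots> \<le> C1_norm_bdry s w"
    unfolding C1_norm_bdry_def using pos[OF C(1)] pos[OF C(2)] by simp
  finally show ?thesis .
qed

lemma C1_uptoI:
  assumes "0 < s" "C0_upto s w" "C0_upto s w'" "\<And>k. C0_upto s (w1 k)" "has_partial_t s w w'"
    and "\<And>k t. t \<in> {0..s} \<Longrightarrow> has_partial_x k (\<lambda>x. w x t) (\<lambda>x. w1 k x t)"
  shows "C1_upto s w"
  unfolding C1_upto_def closed_cell_eq
proof (intro conjI allI ballI)
  show "C0_upto s (partial_t s w)"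
    by (rule C0_upto_cong[OF assms(3) partial_t_eq[OF assms(5,1)]])
  show "C0_upto s (\<lambda>x t. partial_x k (\<lambda>y. w y t) x)" for k
    by (rule C0_upto_cong[OF assms(4) partial_x_eq[OF assms(6)]])
qed (use assms differentiable_t_of_has_partial_t differentiable_x_of_has_partial_x in blast)+

lemma norm_grad_square: "(norm (grad g x))\<^sup>2 = (\<Sum>k\<in>UNIV. (partial_x k g x)\<^sup>2)"
  unfolding power2_norm_eq_inner inner_vec_def grad_def by (simp add: power2_eq_square)

lemma surface_area_eq: "surface_area TYPE('d::finite) = 2 * real CARD('d)"
  by (simp add: surface_area_def surface_integral_def face_integral_eq content_unit_cbox)

lemma surface_integral_eq:
  assumes "\<And>k. continuous_on (cbox 0 1) (g k)"
  shows "surface_integral g = (\<Sum>k\<in>UNIV. integral (cbox 0 1) (\<lambda>x. g k (set_coord k 0 x))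
     + integral (cbox 0 1) (\<lambda>x. g k (set_coord k 1 x)))"
  unfolding surface_integral_def by (simp add: face_integral_eq assms)

section \<open>Regularity and periodicity of the solution\<close>

text \<open>
  The equation \<open>u_t = v\<close> holds on the half-open cell by assumption and extends to the closed cube by
  continuity. Periodicity of v follows by differentiating that of u in time.
\<close>
lemma solution_regular:
  fixes u v :: "real ^ 'd \<Rightarrow> real \<Rightarrow> real"
  assumes sol: "classical_wave_solution T f \<psi>1 \<psi>2 u v"
    and s: "0 < s" "s \<le> T" and u: "C1_upto s u" and v: "C0_upto s v"
  obtains vt :: "real ^ 'd \<Rightarrow> real \<Rightarrow> real" and u1 u2 :: "'d \<Rightarrow> real ^ 'd \<Rightarrow> real \<Rightarrow> real" where
    "C0_upto s vt" "\<And>k. C0_upto s (u1 k)" "\<And>k. C0_upto s (u2 k)"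
    "has_partial_t s u v" "has_partial_t s v vt"
    "\<And>k t. t \<in> {0..s} \<Longrightarrow> has_partial_x k (\<lambda>x. u x t) (\<lambda>x. u1 k x t)"
    "\<And>k t. t \<in> {0..s} \<Longrightarrow> has_partial_x k (\<lambda>x. u1 k x t) (\<lambda>x. u2 k x t)"
    "\<And>x t. x \<in> cell \<Longrightarrow> t \<in> {0..s} \<Longrightarrow> f x t = vt x t - (\<Sum>k\<in>UNIV. u2 k x t)"
    "\<And>k x t. x \<in> cbox 0 1 \<Longrightarrow> t \<in> {0..s} \<Longrightarrow> v (set_coord k 1 x) t = v (set_coord k 0 x) t"
    "\<And>k x t. x \<in> cbox 0 1 \<Longrightarrow> t \<in> {0..s} \<Longrightarrow> u1 k (set_coord k 1 x) t = u1 k (set_coord k 0 x) t"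
proof -
  define u1 where "u1 k x t = partial_x k (\<lambda>y. u y t) x" for k x t
  define u2 where "u2 k x t = partial_x k (partial_x k (\<lambda>y. u y t)) x" for k x t
  define vt where "vt = partial_t T v"
  note S = sol[unfolded classical_wave_solution_def closed_cell_eq]
  have S_per: "u x t = u (opposite k x) t \<and> grad (\<lambda>y. u y t) x = grad (\<lambda>y. u y t) (opposite k x)"
    if "x \<in> cell_boundary" "t \<in> {0..T}" "x $ k \<in> {0, 1}" for k x t
    using S that by blast
  have ut: "has_partial_t T u (partial_t T u)" and vt': "has_partial_t T v vt"
    unfolding vt_def using S by (auto intro!: has_partial_t_partial_t)
  have "partial_t T u x t = v x t" if "x \<in> cbox 0 1" "t \<in> {0..s}" for x t
  proof (rule C0_upto_eq_on_closed_cell[OF _ v _ that])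
    show "C0_upto s (partial_t T u)" using S s(2) by (blast intro: C0_upto_mono)
    show "partial_t T u x t = v x t" if "x \<in> cell" "t \<in> {0..s}" for x t
      using S s that by force
  qed
  then have uv: "has_partial_t s u v"
    by (intro has_partial_t_cong[OF has_partial_t_mono[OF ut s(2)]]) auto
  have per: "u (set_coord k 1 x) t = u (set_coord k 0 x) t \<and>
      u1 k (set_coord k 1 x) t = u1 k (set_coord k 0 x) t"
    if x: "x \<in> cbox 0 1" and t: "t \<in> {0..s}" for k x t
  proof -
    have "u (set_coord k 1 x) t = u (opposite k (set_coord k 1 x)) t \<and>
      grad (\<lambda>y. u y t) (set_coord k 1 x) = grad (\<lambda>y. u y t) (opposite k (set_coord k 1 x))"
      by (rule S_per) (use set_coord_in_boundary[OF x, of 1 k] t s in auto)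
    then show ?thesis by (simp add: u1_def grad_def vec_eq_iff)
  qed
  show ?thesis
  proof (rule that[of vt u1 u2])
    show "C0_upto s vt" unfolding vt_def using S s(2) by (blast intro: C0_upto_mono)
    show "C0_upto s (u1 k)" for k
      using u unfolding C1_upto_def u1_def by simp
    have "C0_upto T (u2 k)" for k using S unfolding u2_def by simp
    then show "C0_upto s (u2 k)" for k using s(2) by (rule C0_upto_mono)
    show "has_partial_t s u v" by fact
    show "has_partial_t s v vt" by (rule has_partial_t_mono[OF vt' s(2)])
    show "has_partial_x k (\<lambda>x. u x t) (\<lambda>x. u1 k x t)"
      "has_partial_x k (\<lambda>x. u1 k x t) (\<lambda>x. u2 k x t)" if t: "t \<in> {0..s}" for k t
    proof -
      have d: "differentiable_x k (\<lambda>y. u y t) x" "differentiable_x k (partial_x k (\<lambda>y. u y t)) x"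
        if "x \<in> cbox 0 1" for x
        using S s t that by auto
      show "has_partial_x k (\<lambda>x. u x t) (\<lambda>x. u1 k x t)"
        unfolding u1_def by (rule has_partial_x_partial_x[OF d(1)])
      show "has_partial_x k (\<lambda>x. u1 k x t) (\<lambda>x. u2 k x t)"
        unfolding u1_def u2_def by (rule has_partial_x_partial_x[OF d(2)])
    qed
    show "f x t = vt x t - (\<Sum>k\<in>UNIV. u2 k x t)" if "x \<in> cell" "t \<in> {0..s}" for x t
      using S s that by (simp add: vt_def u2_def laplacian_def)
    show "u1 k (set_coord k 1 x) t = u1 k (set_coord k 0 x) t" if "x \<in> cbox 0 1" "t \<in> {0..s}" for k x t
      using per[OF that] by simp
    show "v (set_coord k 1 x) t = v (set_coord k 0 x) t" if x: "x \<in> cbox 0 1" and t: "t \<in> {0..s}" for k x t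
    proof (rule real_derivative_within_unique[OF s(1) t])
      have d: "(u (set_coord k a x) has_real_derivative v (set_coord k a x) t) (at t within {0..s})"
        if "a \<in> {0..1}" for a
        using uv set_coord_in_cbox[OF x that] t by (simp add: has_partial_t_def)
      show "(u (set_coord k 1 x) has_real_derivative v (set_coord k 1 x) t) (at t within {0..s})"
        by (rule d) simp
      show "(u (set_coord k 1 x) has_real_derivative v (set_coord k 0 x) t) (at t within {0..s})"
        using d[of 0, simplified] unfolding has_field_derivative_def
        by (rule has_derivative_transform[OF t, rotated]) (use per x in auto)
    qed
  qed
qed

section \<open>The error on one time block\<close>

lemma C0_upto_opposite:
  assumes "C0_upto s g" shows "C0_upto s (\<lambda>x t. g (opposite k x) t)"
  unfolding C0_upto_def[of s "\<lambda>x t. g (opposite k x) t"] closed_cell_eq case_prod_beta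
  by (rule C0_upto_compose[OF assms])
    (auto simp: opposite_def mem_box_cart intro!: continuous_intros)

lemma integral_energy_triangle:
  fixes a b c d :: "real ^ 'd \<Rightarrow> real" and a1 b1 :: "'d \<Rightarrow> real ^ 'd \<Rightarrow> real"
  assumes [continuous_intros]: "continuous_on (cbox 0 1) a" "continuous_on (cbox 0 1) b"
    "continuous_on (cbox 0 1) c" "continuous_on (cbox 0 1) d"
    "\<And>k. continuous_on (cbox 0 1) (a1 k)" "\<And>k. continuous_on (cbox 0 1) (b1 k)"
  shows "integral (cbox 0 1) (\<lambda>x. (a x + b x)\<^sup>2 + (\<Sum>k\<in>UNIV. (a1 k x + b1 k x)\<^sup>2) + (c x + d x)\<^sup>2) \<le>
    2 * integral (cbox 0 1) (\<lambda>x. (a x)\<^sup>2 + (\<Sum>k\<in>UNIV. (a1 k x)\<^sup>2) + (c x)\<^sup>2) +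
    2 * integral (cbox 0 1) (\<lambda>x. (b x)\<^sup>2 + (\<Sum>k\<in>UNIV. (b1 k x)\<^sup>2) + (d x)\<^sup>2)"
proof -
  let ?f = "\<lambda>x. (a x)\<^sup>2 + (\<Sum>k\<in>UNIV. (a1 k x)\<^sup>2) + (c x)\<^sup>2"
  let ?g = "\<lambda>x. (b x)\<^sup>2 + (\<Sum>k\<in>UNIV. (b1 k x)\<^sup>2) + (d x)\<^sup>2"
  have sq: "(y + z)\<^sup>2 \<le> 2 * y\<^sup>2 + 2 * z\<^sup>2" for y z :: real
    using sum_squares_bound[of y z] by (simp add: power2_sum)
  have i: "(\<lambda>x. 2 * ?f x) integrable_on cbox 0 1" "(\<lambda>x. 2 * ?g x) integrable_on cbox 0 1"
    "(\<lambda>x. (a x + b x)\<^sup>2 + (\<Sum>k\<in>UNIV. (a1 k x + b1 k x)\<^sup>2) + (c x + d x)\<^sup>2) integrable_on cbox 0 1"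
    by (rule integrable_continuous, intro continuous_intros)+
  have "integral (cbox 0 1) (\<lambda>x. (a x + b x)\<^sup>2 + (\<Sum>k\<in>UNIV. (a1 k x + b1 k x)\<^sup>2) + (c x + d x)\<^sup>2) \<le>
      integral (cbox 0 1) (\<lambda>x. 2 * ?f x + 2 * ?g x)"
  proof (rule integral_le[OF i(3) integrable_add[OF i(1,2)]])
    fix x
    have "(\<Sum>k\<in>UNIV. (a1 k x + b1 k x)\<^sup>2) \<le> (\<Sum>k\<in>UNIV. 2 * (a1 k x)\<^sup>2 + 2 * (b1 k x)\<^sup>2)"
      by (intro sum_mono sq)
    then have "(\<Sum>k\<in>UNIV. (a1 k x + b1 k x)\<^sup>2) \<le> 2 * (\<Sum>k\<in>UNIV. (a1 k x)\<^sup>2) + 2 * (\<Sum>k\<in>UNIV. (b1 k x)\<^sup>2)"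
      by (simp add: sum.distrib sum_distrib_left)
    with sq[of "a x" "b x"] sq[of "c x" "d x"]
    show "(a x + b x)\<^sup>2 + (\<Sum>k\<in>UNIV. (a1 k x + b1 k x)\<^sup>2) + (c x + d x)\<^sup>2 \<le> 2 * ?f x + 2 * ?g x"
      by (simp add: distrib_left)
  qed
  then show ?thesis by (simp only: integral_add[OF i(1,2)] integral_mult_right)
qed

text \<open>
  The error on block i, which begins at time a and ends at time s. The suffixes t, 1 and 2 mark derivatives in
  time and first and second derivatives in direction k. The abstract energy estimate is applied on
  all of [0, s], where the network of block i is defined, and used on [a, s].
\<close>
locale block_error =
  fixes T :: real and l i :: nat and s a :: real and f u v vt :: "real ^ 'd \<Rightarrow> real \<Rightarrow> real"
    and u1 u2 U1 U2 Ut1 V1 :: "'d \<Rightarrow> real ^ 'd \<Rightarrow> real \<Rightarrow> real"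
    and U V :: "nat \<Rightarrow> real ^ 'd \<Rightarrow> real \<Rightarrow> real" and Ut Vt :: "real ^ 'd \<Rightarrow> real \<Rightarrow> real"
  assumes T: "0 < T" and i: "1 \<le> i" "i \<le> l"
    and s_eq: "s = time_node T l i" and a_eq: "a = time_node T l (i - 1)"
    and u_C1: "C1_upto s u"
    and C0_fun: "C0_upto s u" "C0_upto s v" "C0_upto s vt" "C0_upto s (u1 k)" "C0_upto s (u2 k)"
      "C0_upto s (U i)" "C0_upto s (V i)" "C0_upto s Ut" "C0_upto s Vt"
      "C0_upto s (U1 k)" "C0_upto s (U2 k)" "C0_upto s (Ut1 k)" "C0_upto s (V1 k)"
    and dt: "has_partial_t s u v" "has_partial_t s v vt" "has_partial_t s (U i) Ut" "has_partial_t s (V i) Vt"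
    and dx: "\<And>k t. t \<in> {0..s} \<Longrightarrow> has_partial_x k (\<lambda>x. u x t) (\<lambda>x. u1 k x t)"
      "\<And>k t. t \<in> {0..s} \<Longrightarrow> has_partial_x k (\<lambda>x. u1 k x t) (\<lambda>x. u2 k x t)"
      "\<And>k t. has_partial_x k (\<lambda>x. U i x t) (\<lambda>x. U1 k x t)"
      "\<And>k t. has_partial_x k (\<lambda>x. U1 k x t) (\<lambda>x. U2 k x t)"
      "\<And>k t. has_partial_x k (\<lambda>x. Ut x t) (\<lambda>x. Ut1 k x t)"
      "\<And>k t. has_partial_x k (\<lambda>x. V i x t) (\<lambda>x. V1 k x t)"
    and f_eq: "\<And>x t. x \<in> cell \<Longrightarrow> t \<in> {0..s} \<Longrightarrow> f x t = vt x t - (\<Sum>k\<in>UNIV. u2 k x t)"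
    and v_periodic: "\<And>k x t. x \<in> cbox 0 1 \<Longrightarrow> t \<in> {0..s} \<Longrightarrow> v (set_coord k 1 x) t = v (set_coord k 0 x) t"
    and u1_periodic: "\<And>k x t. x \<in> cbox 0 1 \<Longrightarrow> t \<in> {0..s} \<Longrightarrow> u1 k (set_coord k 1 x) t = u1 k (set_coord k 0 x) t"
begin

lemma times: "0 < s" "0 \<le> a" "a \<le> s" "s - a = time_step T l" "{a..s} \<subseteq> {0..s}"
proof -
  have "0 < time_step T l" using T i by (simp add: time_step_def)
  moreover have "real (i - 1) = real i - 1" using i by simp
  ultimately show "0 < s" "0 \<le> a" "a \<le> s" "s - a = time_step T l" "{a..s} \<subseteq> {0..s}"
    using i by (auto simp: s_eq a_eq time_node_def algebra_simps)
qed

sublocale wave_error s "\<lambda>x t. U i x t - u x t" "\<lambda>x t. Ut x t - v x t" "\<lambda>x t. V i x t - v x t"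
  "\<lambda>x t. Vt x t - vt x t" "\<lambda>x t. Ut x t - V i x t" "\<lambda>k x t. U1 k x t - u1 k x t"
  "\<lambda>k x t. U2 k x t - u2 k x t" "\<lambda>k x t. Ut1 k x t - V1 k x t"
  by unfold_locales
    (use times in \<open>simp_all add: C0_upto_diff C0_fun has_partial_t_diff dt has_partial_x_diff dx\<close>)

lemma LINT_error:
  assumes t: "t \<in> {0..s}"
  shows "(LINT x : cell | lborel. (U i x t - u x t)\<^sup>2
      + (norm (grad (\<lambda>y. U i y t - u y t) x))\<^sup>2 + (V i x t - v x t)\<^sup>2) = energy t"
  unfolding energy_def
proof (rule LINT_cell)
  show "continuous_on (cbox 0 1) (\<lambda>x. (U i x t - u x t)\<^sup>2 + (\<Sum>k\<in>UNIV. (U1 k x t - u1 k x t)\<^sup>2)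
      + (V i x t - v x t)\<^sup>2)"
    by (rule C0_upto_slice[OF _ t]) (intro C0_upto_intros C0_fun)
  fix x :: "real ^ 'd" assume "x \<in> cell"
  then have "x \<in> cbox 0 1" using cell_sandwich by blast
  then have "partial_x k (\<lambda>y. U i y t - u y t) x = U1 k x t - u1 k x t" for k
    using partial_x_eq[OF has_partial_x_diff[OF dx(3) dx(1)[OF t]]] by blast
  then show "(U i x t - u x t)\<^sup>2 + (norm (grad (\<lambda>y. U i y t - u y t) x))\<^sup>2 + (V i x t - v x t)\<^sup>2 =
      (U i x t - u x t)\<^sup>2 + (\<Sum>k\<in>UNIV. (U1 k x t - u1 k x t)\<^sup>2) + (V i x t - v x t)\<^sup>2"
    by (simp add: norm_grad_square)
qed

lemma LINT_interior:
  "(LINT p : cell \<times> {a..s} | lborel.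
        (R_int1 T l U V i (fst p) (snd p))\<^sup>2 + (R_int2 T l f U V i (fst p) (snd p))\<^sup>2
        + (norm (grad (\<lambda>y. R_int1 T l U V i y (snd p)) (fst p)))\<^sup>2) = integral {a..s} residual"
proof -
  let ?h = "\<lambda>x t. (Ut x t - V i x t)\<^sup>2
      + ((Vt x t - vt x t) - (\<Sum>k\<in>UNIV. U2 k x t - u2 k x t))\<^sup>2
      + (\<Sum>k\<in>UNIV. (Ut1 k x t - V1 k x t)\<^sup>2)"
  have "(LINT p : cell \<times> {a..s} | lborel.
      (\<lambda>x t. (R_int1 T l U V i x t)\<^sup>2 + (R_int2 T l f U V i x t)\<^sup>2
        + (norm (grad (\<lambda>y. R_int1 T l U V i y t) x))\<^sup>2) (fst p) (snd p)) =
      integral {a..s} (\<lambda>t. integral (cbox 0 1) (\<lambda>x. ?h x t))"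
  proof (rule LINT_cell_times_interval)
    have "C0_upto s ?h" by (intro C0_upto_intros C0_fun)
    then show "continuous_on (cbox 0 1 \<times> {a..s}) (\<lambda>(x, t). ?h x t)"
      unfolding C0_upto_def closed_cell_eq by (rule continuous_on_subset) (use times in auto)
    fix x :: "real ^ 'd" and t assume x: "x \<in> cell" and "t \<in> {a..s}"
    then have t: "t \<in> {0..s}" using times by auto
    have x': "x \<in> cbox 0 1" using x cell_sandwich by blast
    have R1: "R_int1 T l U V i y t = Ut y t - V i y t" if "y \<in> cbox 0 1" for y
      using partial_t_eq[OF dt(3) times(1) that t] by (simp add: R_int1_def s_eq)
    have "has_partial_x k (\<lambda>y. R_int1 T l U V i y t) (\<lambda>y. Ut1 k y t - V1 k y t)" for k
      by (rule has_partial_x_cong[OF has_partial_x_diff[OF dx(5,6)]]) (simp_all add: R1)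
    then have R1x: "partial_x k (\<lambda>y. R_int1 T l U V i y t) x = Ut1 k x t - V1 k x t" for k
      by (rule partial_x_eq[OF _ x'])
    have "has_partial_x k (partial_x k (\<lambda>y. U i y t)) (\<lambda>x. U2 k x t)" for k
      by (rule has_partial_x_cong[OF dx(4)]) (simp_all add: partial_x_eq[OF dx(3)])
    then have "partial_x k (partial_x k (\<lambda>y. U i y t)) x = U2 k x t" for k
      by (rule partial_x_eq[OF _ x'])
    then have "laplacian (\<lambda>y. U i y t) x = (\<Sum>k\<in>UNIV. U2 k x t)"
      by (simp add: laplacian_def)
    then have "R_int2 T l f U V i x t = (Vt x t - vt x t) - (\<Sum>k\<in>UNIV. U2 k x t - u2 k x t)"
      using partial_t_eq[OF dt(4) times(1) x' t] f_eq[OF x t]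
      by (simp add: R_int2_def s_eq[symmetric] sum_subtractf)
    then show "(R_int1 T l U V i x t)\<^sup>2 + (R_int2 T l f U V i x t)\<^sup>2
        + (norm (grad (\<lambda>y. R_int1 T l U V i y t) x))\<^sup>2 = ?h x t"
      by (simp only: R1[OF x'] norm_grad_square R1x)
  qed
  then show ?thesis by (simp only: residual_def[abs_def])
qed

text \<open>The squared jumps of the error in V and in the normal derivative of U between opposite faces,
  integrated over the faces and over the block. By periodicity of the solution they are jumps of
  the networks.\<close>
definition jump1 :: real where
  "jump1 = integral {a..s} (\<lambda>t. \<Sum>k\<in>UNIV. integral (cbox 0 1)
     (\<lambda>x. ((V i (set_coord k 1 x) t - v (set_coord k 1 x) t) - (V i (set_coord k 0 x) t - v (set_coord k 0 x) t))\<^sup>2))"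

definition jump2 :: real where
  "jump2 = integral {a..s} (\<lambda>t. \<Sum>k\<in>UNIV. integral (cbox 0 1)
     (\<lambda>x. ((U1 k (set_coord k 1 x) t - u1 k (set_coord k 1 x) t) - (U1 k (set_coord k 0 x) t - u1 k (set_coord k 0 x) t))\<^sup>2))"

text \<open>Both faces of an opposite pair contribute the same squared jump to the surface integral.\<close>
lemma jump1_le:
  "2 * jump1 \<le> (LINT t : {a..s} | lborel. surface_integral (\<lambda>k x. (R_sb1 V i k x t)\<^sup>2))"
proof -
  let ?J = "\<lambda>t. \<Sum>k\<in>UNIV. integral (cbox 0 1) (\<lambda>x. (V i (set_coord k 1 x) t - V i (set_coord k 0 x) t)\<^sup>2)"
  have J: "continuous_on {a..s} ?J"
    by (rule continuous_on_subset[OF _ times(5)],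
      intro continuous_on_sum continuous_on_integral_cube C0_upto_intros C0_fun; simp)
  have "(LINT t : {a..s} | lborel. surface_integral (\<lambda>k x. (R_sb1 V i k x t)\<^sup>2)) =
      integral {a..s} (\<lambda>t. 2 * ?J t)"
  proof (rule LINT_interval)
    show "continuous_on {a..s} (\<lambda>t. 2 * ?J t)" by (intro continuous_intros J)
    fix t assume "t \<in> {a..s}"
    then have t: "t \<in> {0..s}" using times by auto
    have "continuous_on (cbox 0 1) (\<lambda>x. (R_sb1 V i k x t)\<^sup>2)" for k
      unfolding R_sb1_def
      by (rule C0_upto_slice[OF _ t]) (intro C0_upto_intros C0_upto_opposite C0_fun)
    from surface_integral_eq[OF this]
    have "surface_integral (\<lambda>k x. (R_sb1 V i k x t)\<^sup>2) = (\<Sum>k\<in>UNIV.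
       integral (cbox 0 1) (\<lambda>x. (V i (set_coord k 0 x) t - V i (set_coord k 1 x) t)\<^sup>2) +
       integral (cbox 0 1) (\<lambda>x. (V i (set_coord k 1 x) t - V i (set_coord k 0 x) t)\<^sup>2))"
      by (simp add: R_sb1_def)
    also have "\<dots> = (\<Sum>k\<in>UNIV. 2 * integral (cbox 0 1) (\<lambda>x. (V i (set_coord k 1 x) t - V i (set_coord k 0 x) t)\<^sup>2))"
      by (simp add: power2_commute)
    finally show "surface_integral (\<lambda>k x. (R_sb1 V i k x t)\<^sup>2) = 2 * ?J t"
      by (simp add: sum_distrib_left)
  qed
  also have "\<dots> = 2 * integral {a..s} ?J" by simp
  also have "integral {a..s} ?J = jump1"
    unfolding jump1_def
  proof (intro integral_cong sum.cong refl)
    fix t k and x :: "real ^ 'd" assume "t \<in> {a..s}" "x \<in> cbox 0 1"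
    then show "(V i (set_coord k 1 x) t - V i (set_coord k 0 x) t)\<^sup>2 =
        ((V i (set_coord k 1 x) t - v (set_coord k 1 x) t) - (V i (set_coord k 0 x) t - v (set_coord k 0 x) t))\<^sup>2"
      using v_periodic[of x t k] times by auto
  qed
  finally show ?thesis by simp
qed

text \<open>Only the normal component of the jump of the gradient occurs in \<open>jump2\<close>, hence an inequality.\<close>
lemma jump2_le:
  "2 * jump2 \<le> (LINT t : {a..s} | lborel. surface_integral (\<lambda>k x. (norm (R_sb2 U i k x t))\<^sup>2))"
proof -
  define G where "G k x t = (\<Sum>j\<in>UNIV. (U1 j (set_coord k 1 x) t - U1 j (set_coord k 0 x) t)\<^sup>2)" for k x t
  let ?J = "\<lambda>t. \<Sum>k\<in>UNIV. integral (cbox 0 1) (\<lambda>x. G k x t)"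
  have G: "C0_upto s (G k)" for k
    unfolding G_def by (intro C0_upto_intros C0_fun; simp)
  have J: "continuous_on {a..s} ?J"
    by (rule continuous_on_subset[OF _ times(5)], intro continuous_on_sum continuous_on_integral_cube G)
  have "(LINT t : {a..s} | lborel. surface_integral (\<lambda>k x. (norm (R_sb2 U i k x t))\<^sup>2)) =
      integral {a..s} (\<lambda>t. 2 * ?J t)"
  proof (rule LINT_interval)
    show "continuous_on {a..s} (\<lambda>t. 2 * ?J t)" by (intro continuous_intros J)
    fix t assume "t \<in> {a..s}"
    then have t: "t \<in> {0..s}" using times by auto
    have R: "(norm (R_sb2 U i k x t))\<^sup>2 = (\<Sum>j\<in>UNIV. (U1 j x t - U1 j (opposite k x) t)\<^sup>2)"
      if x: "x \<in> cbox 0 1" for k x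
    proof -
      have "opposite k x \<in> cbox 0 1" using x by (simp add: opposite_def mem_box_cart)
      then show ?thesis
        unfolding R_sb2_def power2_norm_eq_inner inner_vec_def
        by (simp add: grad_def partial_x_eq[OF dx(3)] x power2_eq_square)
    qed
    have "continuous_on (cbox 0 1) (\<lambda>x. \<Sum>j\<in>UNIV. (U1 j x t - U1 j (opposite k x) t)\<^sup>2)" for k
      by (rule C0_upto_slice[OF _ t]) (intro C0_upto_intros C0_upto_opposite C0_fun)
    then have "continuous_on (cbox 0 1) (\<lambda>x. (norm (R_sb2 U i k x t))\<^sup>2)" for k
      by (subst continuous_on_cong[OF refl R])
    from surface_integral_eq[OF this]
    have "surface_integral (\<lambda>k x. (norm (R_sb2 U i k x t))\<^sup>2) = (\<Sum>k\<in>UNIV.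
        integral (cbox 0 1) (\<lambda>x. (norm (R_sb2 U i k (set_coord k 0 x) t))\<^sup>2) +
        integral (cbox 0 1) (\<lambda>x. (norm (R_sb2 U i k (set_coord k 1 x) t))\<^sup>2))" .
    also have "\<dots> = (\<Sum>k\<in>UNIV. integral (cbox 0 1) (\<lambda>x. G k x t) + integral (cbox 0 1) (\<lambda>x. G k x t))"
      by (intro sum.cong arg_cong2[where f = "(+)"] integral_cong refl)
        (simp_all add: R set_coord_in_cbox G_def power2_commute)
    finally show "surface_integral (\<lambda>k x. (norm (R_sb2 U i k x t))\<^sup>2) = 2 * ?J t"
      by (simp add: sum_distrib_left)
  qed
  also have "\<dots> = 2 * integral {a..s} ?J" by simp
  finally have eq: "(LINT t : {a..s} | lborel. surface_integral (\<lambda>k x. (norm (R_sb2 U i k x t))\<^sup>2)) =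
      2 * integral {a..s} ?J" .
  have H: "C0_upto s (\<lambda>x t. ((U1 k (set_coord k 1 x) t - u1 k (set_coord k 1 x) t) -
      (U1 k (set_coord k 0 x) t - u1 k (set_coord k 0 x) t))\<^sup>2)" for k
    by (intro C0_upto_intros C0_fun; simp)
  have "jump2 \<le> integral {a..s} ?J"
    unfolding jump2_def
  proof (rule integral_le)
    show "?J integrable_on {a..s}" by (rule integrable_continuous_interval[OF J])
    show "(\<lambda>t. \<Sum>k\<in>UNIV. integral (cbox 0 1) (\<lambda>x. ((U1 k (set_coord k 1 x) t - u1 k (set_coord k 1 x) t) -
      (U1 k (set_coord k 0 x) t - u1 k (set_coord k 0 x) t))\<^sup>2)) integrable_on {a..s}"
      by (rule integrable_continuous_interval, rule continuous_on_subset[OF _ times(5)])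
        (intro continuous_on_sum continuous_on_integral_cube H)
    fix t assume "t \<in> {a..s}"
    then have t: "t \<in> {0..s}" using times by auto
    show "(\<Sum>k\<in>UNIV. integral (cbox 0 1) (\<lambda>x. ((U1 k (set_coord k 1 x) t - u1 k (set_coord k 1 x) t) -
      (U1 k (set_coord k 0 x) t - u1 k (set_coord k 0 x) t))\<^sup>2)) \<le> ?J t"
    proof (intro sum_mono integral_le integrable_C0[OF _ t] G H)
      fix k and x :: "real ^ 'd" assume "x \<in> cbox 0 1"
      then have "((U1 k (set_coord k 1 x) t - u1 k (set_coord k 1 x) t) -
          (U1 k (set_coord k 0 x) t - u1 k (set_coord k 0 x) t))\<^sup>2 =
          (U1 k (set_coord k 1 x) t - U1 k (set_coord k 0 x) t)\<^sup>2"
        using u1_periodic[of x t k] t by simp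
      also have "\<dots> \<le> G k x t"
        unfolding G_def
        by (rule member_le_sum[where f = "\<lambda>j. (U1 j (set_coord k 1 x) t - U1 j (set_coord k 0 x) t)\<^sup>2"]) auto
      finally show "((U1 k (set_coord k 1 x) t - u1 k (set_coord k 1 x) t) -
          (U1 k (set_coord k 0 x) t - u1 k (set_coord k 0 x) t))\<^sup>2 \<le> G k x t" .
    qed
  qed
  then show ?thesis using eq by simp
qed

lemma jump_nonneg: "0 \<le> jump1" "0 \<le> jump2"
proof -
  have "0 \<le> integral (cbox 0 1) (\<lambda>x. (g x)\<^sup>2)" for g :: "real ^ 'd \<Rightarrow> real"
    by (cases "(\<lambda>x. (g x)\<^sup>2) integrable_on cbox 0 1")
      (auto intro: integral_nonneg simp: not_integrable_integral)
  then have *: "0 \<le> (\<Sum>k\<in>UNIV. integral (cbox 0 1) (\<lambda>x. (g k x)\<^sup>2))" for g :: "'d \<Rightarrow> real ^ 'd \<Rightarrow> real"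
    by (intro sum_nonneg)
  have "0 \<le> integral {a..s} (\<lambda>t. \<Sum>k\<in>UNIV. integral (cbox 0 1) (\<lambda>x. (g k x t)\<^sup>2))"
    for g :: "'d \<Rightarrow> real ^ 'd \<Rightarrow> real \<Rightarrow> real"
    by (cases "(\<lambda>t. \<Sum>k\<in>UNIV. integral (cbox 0 1) (\<lambda>x. (g k x t)\<^sup>2)) integrable_on {a..s}")
      (auto intro: integral_nonneg * simp: not_integrable_integral)
  note J = this
  show "0 \<le> jump1" unfolding jump1_def by (rule J)
  show "0 \<le> jump2" unfolding jump2_def by (rule J)
qed

text \<open>The surface area of the cube is 2 d, and I is at least 2 J, so there is a factor of 2 to spare.\<close>
lemma boundary_term:
  assumes "0 \<le> M" "0 \<le> J" "2 * J \<le> I"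
  shows "2 * M * (sqrt (s - a) * sqrt (real CARD('d)) * sqrt J) \<le>
    2 * sqrt \<bar>time_step T l\<bar> * (sqrt (surface_area TYPE('d)) * M) * sqrt I"
proof -
  have "sqrt (real CARD('d)) * sqrt J \<le> sqrt (surface_area TYPE('d)) * sqrt I"
    by (rule mult_mono) (use assms in \<open>auto simp: surface_area_eq intro: order_trans\<close>)
  then have "2 * M * sqrt (s - a) * (sqrt (real CARD('d)) * sqrt J) \<le>
      2 * M * sqrt (s - a) * (sqrt (surface_area TYPE('d)) * sqrt I)"
    using assms times by (intro mult_left_mono) auto
  moreover have "\<bar>time_step T l\<bar> = s - a" using times by simp
  ultimately show ?thesis by (simp add: ac_simps)
qed

lemma U_C1: "C1_upto s (U i)"
  by (rule C1_uptoI[of s _ Ut U1]) (simp_all add: times C0_fun dt dx)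

lemma energy_le:
  assumes \<tau>: "\<tau> \<in> {a..s}"
  shows "energy \<tau> \<le> exp (2 * time_step T l) * (energy a
     + (LINT p : cell \<times> {a..s} | lborel.
        (R_int1 T l U V i (fst p) (snd p))\<^sup>2 + (R_int2 T l f U V i (fst p) (snd p))\<^sup>2
        + (norm (grad (\<lambda>y. R_int1 T l U V i y (snd p)) (fst p)))\<^sup>2)
     + 2 * sqrt \<bar>time_step T l\<bar> * C_bdry1 T l u U i *
         sqrt (LINT t : {a..s} | lborel. surface_integral (\<lambda>k x. (R_sb1 V i k x t)\<^sup>2))
     + 2 * sqrt \<bar>time_step T l\<bar> * C_bdry2 T l v V i *
         sqrt (LINT t : {a..s} | lborel. surface_integral (\<lambda>k x. (norm (R_sb2 U i k x t))\<^sup>2)))"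
proof -
  define M1 where "M1 = C1_norm_bdry s u + C1_norm_bdry s (U i)"
  define M2 where "M2 = sup_norm_bdry s v + sup_norm_bdry s (V i)"
  have M1: "\<bar>U1 k (set_coord k 1 x) t - u1 k (set_coord k 1 x) t\<bar> \<le> M1"
    if x: "x \<in> cbox 0 1" and t: "t \<in> {0..s}" for k x t
  proof -
    have b: "set_coord k 1 x \<in> cell_boundary" and c: "set_coord k 1 x \<in> cbox 0 1"
      using set_coord_in_boundary[OF x] set_coord_in_cbox[OF x] by auto
    show ?thesis
      using partial_x_le_C1_norm_bdry[OF u_C1 b t, of k] partial_x_le_C1_norm_bdry[OF U_C1 b t, of k]
      unfolding M1_def partial_x_eq[OF dx(1)[OF t] c] partial_x_eq[OF dx(3) c] by linarith
  qed
  have M2: "\<bar>V i (set_coord k 0 x) t - v (set_coord k 0 x) t\<bar> \<le> M2"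
    if x: "x \<in> cbox 0 1" and t: "t \<in> {0..s}" for k x t
  proof -
    have b: "set_coord k 0 x \<in> cell_boundary" using set_coord_in_boundary[OF x] by auto
    show ?thesis
      using sup_norm_bdry_upper[OF C0_fun(2) b t] sup_norm_bdry_upper[OF C0_fun(7) b t]
      unfolding M2_def by linarith
  qed
  have M_nonneg: "0 \<le> M1" "0 \<le> M2"
    using M1[of 0 0] M2[of 0 0] times abs_ge_zero by (force simp: mem_box_cart intro: order_trans)+
  have "energy \<tau> \<le> exp (2 * (s - a)) * (energy a + integral {a..s} residual
    + 2 * M1 * (sqrt (s - a) * sqrt (real CARD('d)) * sqrt jump1)
    + 2 * M2 * (sqrt (s - a) * sqrt (real CARD('d)) * sqrt jump2))"
    unfolding jump1_def jump2_def
    by (rule energy_bound[OF times(2,3) order_refl M1 M2 \<tau>])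
  also have "\<dots> \<le> exp (2 * (s - a)) * (energy a + integral {a..s} residual
     + 2 * sqrt \<bar>time_step T l\<bar> * (sqrt (surface_area TYPE('d)) * M1) *
         sqrt (LINT t : {a..s} | lborel. surface_integral (\<lambda>k x. (R_sb1 V i k x t)\<^sup>2))
     + 2 * sqrt \<bar>time_step T l\<bar> * (sqrt (surface_area TYPE('d)) * M2) *
         sqrt (LINT t : {a..s} | lborel. surface_integral (\<lambda>k x. (norm (R_sb2 U i k x t))\<^sup>2)))"
    by (intro mult_left_mono add_mono order_refl boundary_term M_nonneg jump_nonneg jump1_le jump2_le) simp
  finally show ?thesis
    unfolding LINT_interior C_bdry1_def C_bdry2_def M1_def M2_def s_eq[symmetric] times(4) .
qed

end

context block_error
begin

text \<open>
  P and Q continue the final state of the previous block from the cell to the closed cube; on the first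
  block that state is given by the initial data, which are prescribed on the cell only.
\<close>
lemma energy_initial:
  fixes P Q :: "real ^ 'd \<Rightarrow> real" and P1 :: "'d \<Rightarrow> real ^ 'd \<Rightarrow> real"
  assumes cont: "continuous_on (cbox 0 1) P" "continuous_on (cbox 0 1) Q"
      "\<And>k. continuous_on (cbox 0 1) (P1 k)"
    and P1: "\<And>k. has_partial_x k P (P1 k)"
    and P: "\<And>x. x \<in> cell \<Longrightarrow> U (i - 1) x a = P x" and Q: "\<And>x. x \<in> cell \<Longrightarrow> V (i - 1) x a = Q x"
  shows "energy a \<le> 2 * (LINT x : cell | lborel.
         (R_tb T l U i i x)\<^sup>2 + (R_tb T l V i i x)\<^sup>2 + (norm (grad (R_tb T l U i i) x))\<^sup>2)
    + 2 * integral (cbox 0 1) (\<lambda>x. (P x - u x a)\<^sup>2 + (\<Sum>k\<in>UNIV. (P1 k x - u1 k x a)\<^sup>2) + (Q x - v x a)\<^sup>2)"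
proof -
  have a: "a \<in> {0..s}" using times by auto
  note slice = C0_upto_slice[OF _ a]
  have tb: "R_tb T l W i i x = W i x a - W (i - 1) x a" for W :: "nat \<Rightarrow> real ^ 'd \<Rightarrow> real \<Rightarrow> real" and x
    by (simp add: R_tb_def a_eq)
  let ?g = "\<lambda>x. (U i x a - P x)\<^sup>2 + (\<Sum>k\<in>UNIV. (U1 k x a - P1 k x)\<^sup>2) + (V i x a - Q x)\<^sup>2"
  have c: "continuous_on (cbox 0 1) (\<lambda>x. U i x a - P x)" "continuous_on (cbox 0 1) (\<lambda>x. P x - u x a)"
    "continuous_on (cbox 0 1) (\<lambda>x. V i x a - Q x)" "continuous_on (cbox 0 1) (\<lambda>x. Q x - v x a)"
    "continuous_on (cbox 0 1) (\<lambda>x. U1 k x a - P1 k x)" "continuous_on (cbox 0 1) (\<lambda>x. P1 k x - u1 k x a)" for k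
    by (rule continuous_on_diff; rule cont slice[OF C0_fun(1)] slice[OF C0_fun(2)] slice[OF C0_fun(4)]
        slice[OF C0_fun(6)] slice[OF C0_fun(7)] slice[OF C0_fun(10)])+
  have "(LINT x : cell | lborel.
      (R_tb T l U i i x)\<^sup>2 + (R_tb T l V i i x)\<^sup>2 + (norm (grad (R_tb T l U i i) x))\<^sup>2) = integral (cbox 0 1) ?g"
  proof (rule LINT_cell)
    show "continuous_on (cbox 0 1) ?g" by (intro continuous_intros c)
    fix x :: "real ^ 'd" assume x: "x \<in> cell"
    have "partial_x k (R_tb T l U i i) x = U1 k x a - P1 k x" for k
      by (rule partial_x_eq_on_cell[OF has_partial_x_diff[OF dx(3) P1] _ x])
        (simp only: tb P)
    then show "(R_tb T l U i i x)\<^sup>2 + (R_tb T l V i i x)\<^sup>2 + (norm (grad (R_tb T l U i i) x))\<^sup>2 = ?g x"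
      by (simp only: norm_grad_square tb P[OF x] Q[OF x])
  qed
  then show ?thesis
    using integral_energy_triangle[where ?a1.0 = "\<lambda>k x. U1 k x a - P1 k x"
        and ?b1.0 = "\<lambda>k x. P1 k x - u1 k x a", OF c]
    by (simp add: energy_def)
qed

lemma LINT_time_error_le:
  assumes "\<And>t. t \<in> {a..s} \<Longrightarrow> energy t \<le> K"
  shows "(LINT t : {a..s} | lborel. (LINT x : cell | lborel. (U i x t - u x t)\<^sup>2
      + (norm (grad (\<lambda>y. U i y t - u y t) x))\<^sup>2 + (V i x t - v x t)\<^sup>2)) \<le> K * time_step T l"
proof -
  have "continuous_on {0..s} energy"
    by (auto simp: continuous_on_eq_continuous_within elim!: energy_deriv dest: DERIV_continuous)
  then have c: "continuous_on {a..s} energy" by (rule continuous_on_subset[OF _ times(5)])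
  have "(LINT t : {a..s} | lborel. (LINT x : cell | lborel. (U i x t - u x t)\<^sup>2
      + (norm (grad (\<lambda>y. U i y t - u y t) x))\<^sup>2 + (V i x t - v x t)\<^sup>2)) = integral {a..s} energy"
    by (rule LINT_interval[OF c LINT_error]) (use times in auto)
  also have "\<dots> \<le> integral {a..s} (\<lambda>_. K)"
    using assms by (intro integral_le integrable_continuous_interval c) auto
  finally show ?thesis using times by (simp add: mult.commute)
qed

end

section \<open>Induction over the time blocks\<close>

lemma time_node_mono: "0 \<le> T \<Longrightarrow> j \<le> k \<Longrightarrow> time_node T l j \<le> time_node T l k"
  unfolding time_node_def time_step_def by (intro mult_right_mono) auto

lemma time_node_pos: "0 < T \<Longrightarrow> 1 \<le> j \<Longrightarrow> j \<le> l \<Longrightarrow> 0 < time_node T l j"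
  by (simp add: time_node_def time_step_def)

lemma time_node_le: "0 \<le> T \<Longrightarrow> j \<le> l \<Longrightarrow> time_node T l j \<le> T"
  using time_node_mono[of T j l l] by (cases "l = 0") (auto simp: time_node_def time_step_def)

lemma block_error_exists:
  fixes u v :: "real ^ 'd \<Rightarrow> real \<Rightarrow> real"
  assumes T: "0 < T" and i: "1 \<le> i" "i \<le> l"
    and sol: "classical_wave_solution T f \<psi>1 \<psi>2 u v"
    and u: "C1_upto (time_node T l i) u" and v: "C0_upto (time_node T l i) v"
    and net: "hlconc_pinn m n \<theta>u" "hlconc_pinn m n \<theta>v" "U i = net_function \<theta>u" "V i = net_function \<theta>v"
  obtains vt u1 u2 U1 U2 Ut1 V1 Ut Vt where
    "block_error T l i (time_node T l i) (time_node T l (i - 1)) f u v vt u1 u2 U1 U2 Ut1 V1 U V Ut Vt"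
proof -
  let ?s = "time_node T l i"
  have s: "0 < ?s" "?s \<le> T"
    using T i by (auto intro: time_node_pos time_node_le)
  obtain vt u1 u2 where u': 
    "C0_upto ?s vt" "\<And>k. C0_upto ?s (u1 k)" "\<And>k. C0_upto ?s (u2 k)"
    "has_partial_t ?s u v" "has_partial_t ?s v vt"
    "\<And>k t. t \<in> {0..?s} \<Longrightarrow> has_partial_x k (\<lambda>x. u x t) (\<lambda>x. u1 k x t)"
    "\<And>k t. t \<in> {0..?s} \<Longrightarrow> has_partial_x k (\<lambda>x. u1 k x t) (\<lambda>x. u2 k x t)"
    "\<And>x t. x \<in> cell \<Longrightarrow> t \<in> {0..?s} \<Longrightarrow> f x t = vt x t - (\<Sum>k\<in>UNIV. u2 k x t)"
    "\<And>k x t. x \<in> cbox 0 1 \<Longrightarrow> t \<in> {0..?s} \<Longrightarrow> v (set_coord k 1 x) t = v (set_coord k 0 x) t"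
    "\<And>k x t. x \<in> cbox 0 1 \<Longrightarrow> t \<in> {0..?s} \<Longrightarrow> u1 k (set_coord k 1 x) t = u1 k (set_coord k 0 x) t"
    using solution_regular[OF sol s u v] by blast
  have u0: "C0_upto ?s u" using u by (simp add: C1_upto_def)
  obtain Ut U1 U2 Ut1 where U':
    "\<And>s. C0_upto s (U i)" "\<And>s. C0_upto s Ut"
    "\<And>s k. C0_upto s (U1 k)" "\<And>s k. C0_upto s (U2 k)" "\<And>s k. C0_upto s (Ut1 k)"
    "\<And>s. has_partial_t s (U i) Ut"
    "\<And>k t. has_partial_x k (\<lambda>x. U i x t) (\<lambda>x. U1 k x t)"
    "\<And>k t. has_partial_x k (\<lambda>x. U1 k x t) (\<lambda>x. U2 k x t)"
    "\<And>k t. has_partial_x k (\<lambda>x. Ut x t) (\<lambda>x. Ut1 k x t)"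
    using net_function_regular[OF net(1), where 'd = 'd] unfolding net(3) by metis
  obtain Vt V1 where V':
    "\<And>s. C0_upto s (V i)" "\<And>s. C0_upto s Vt" "\<And>s k. C0_upto s (V1 k)"
    "\<And>s. has_partial_t s (V i) Vt"
    "\<And>k t. has_partial_x k (\<lambda>x. V i x t) (\<lambda>x. V1 k x t)"
    using net_function_regular[OF net(2), where 'd = 'd] unfolding net(4) by metis
  have "block_error T l i ?s (time_node T l (i - 1)) f u v vt u1 u2 U1 U2 Ut1 V1 U V Ut Vt"
    by (rule block_error.intro) (assumption | rule T i refl u u0 v u' U' V')+
  then show ?thesis by (rule that)
qed

text \<open>The derivative in time within [0, s] does not depend on s.\<close>
lemma C1_upto_mono:
  assumes sol: "classical_wave_solution T f \<psi>1 \<psi>2 u v"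
    and u: "C1_upto s u" and v: "C0_upto s v" and s: "0 < s'" "s' \<le> s" "s \<le> T"
  shows "C1_upto s' u"
proof -
  have pos: "0 < s" using s by simp
  obtain u1 where u1: "\<And>k. C0_upto s (u1 k)" "has_partial_t s u v"
    "\<And>k t. t \<in> {0..s} \<Longrightarrow> has_partial_x k (\<lambda>x. u x t) (\<lambda>x. u1 k x t)"
    using solution_regular[OF sol pos s(3) u v] by metis
  have u0: "C0_upto s u" using u by (simp add: C1_upto_def)
  show ?thesis
    by (intro C1_uptoI[of s' u v u1] s(1) C0_upto_mono[OF _ s(2)] has_partial_t_mono[OF u1(2) s(2)]
        u0 v u1(1,3)) (use s in auto)
qed

lemma energy_le_C_G:
  fixes f u v :: "real ^ 'd \<Rightarrow> real \<Rightarrow> real"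
  assumes T: "0 < T" and i: "i \<le> l"
    and sol: "classical_wave_solution T f \<psi>1 \<psi>2 u v"
    and u: "C1_upto (time_node T l i) u" and v: "C0_upto (time_node T l i) v"
    and net: "\<And>j. j \<in> {1..i} \<Longrightarrow> hlconc_pinn m n (\<theta>u j)" "\<And>j. j \<in> {1..i} \<Longrightarrow> hlconc_pinn m n (\<theta>v j)"
      "\<And>j. j \<in> {1..i} \<Longrightarrow> U j = net_function (\<theta>u j)" "\<And>j. j \<in> {1..i} \<Longrightarrow> V j = net_function (\<theta>v j)"
    and init: "\<And>x. x \<in> cell \<Longrightarrow> U 0 x (time_node T l 0) = \<psi>1 x"
      "\<And>x. x \<in> cell \<Longrightarrow> V 0 x (time_node T l 0) = \<psi>2 x"
    and j: "1 \<le> j" "j \<le> i" and \<tau>: "\<tau> \<in> {time_node T l (j - 1)..time_node T l j}"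
  shows "(LINT x : cell | lborel. (U j x \<tau> - u x \<tau>)\<^sup>2
      + (norm (grad (\<lambda>y. U j y \<tau> - u y \<tau>) x))\<^sup>2 + (V j x \<tau> - v x \<tau>)\<^sup>2)
    \<le> C_G T l f u v U V j * exp (2 * time_step T l)"
  using j \<tau>
proof (induction j arbitrary: \<tau>)
  case 0
  then show ?case by simp
next
  case (Suc n)
  have le: "time_node T l (Suc n) \<le> time_node T l i" "time_node T l i \<le> T" "0 < time_node T l (Suc n)"
    using T i Suc.prems(2) by (auto intro: time_node_pos time_node_le time_node_mono)
  have u': "C1_upto (time_node T l (Suc n)) u" by (rule C1_upto_mono[OF sol u v le(3,1,2)])
  have v': "C0_upto (time_node T l (Suc n)) v" by (rule C0_upto_mono[OF v le(1)])
  have Sn: "Suc n \<in> {1..i}" "Suc n \<le> l" using Suc.prems i by auto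
  obtain vt u1 u2 U1 U2 Ut1 V1 Ut Vt where
    block: "block_error T l (Suc n) (time_node T l (Suc n)) (time_node T l (Suc n - 1))
      f u v vt u1 u2 U1 U2 Ut1 V1 U V Ut Vt"
    by (rule block_error_exists[where U = U and V = V, OF T Suc.prems(1) Sn(2) sol u' v'
      net(1)[OF Sn(1)] net(2)[OF Sn(1)] net(3)[OF Sn(1)] net(4)[OF Sn(1)]])
  interpret block_error T l "Suc n" "time_node T l (Suc n)" "time_node T l (Suc n - 1)"
      f u v vt u1 u2 U1 U2 Ut1 V1 U V Ut Vt
    by (rule block)
  let ?a = "time_node T l n"
  let ?tb = "\<lambda>j. LINT x : cell | lborel.
         (R_tb T l U (Suc n) j x)\<^sup>2 + (R_tb T l V (Suc n) j x)\<^sup>2 + (norm (grad (R_tb T l U (Suc n) j) x))\<^sup>2"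
  have a: "?a \<in> {0..time_node T l (Suc n)}" using times by simp
  have "energy ?a \<le> 2 * ?tb (Suc n) + 2 * C_G T l f u v U V n * exp (2 * time_step T l)"
  proof (cases "n = 0")
    case True
    have u0: "u x ?a = \<psi>1 x" "v x ?a = \<psi>2 x" if "x \<in> cell" for x
      using sol that unfolding classical_wave_solution_def True by (auto simp: time_node_def)
    \<comment> \<open>The initial data are those of u and v, so the previous error vanishes.\<close>
    have "energy ?a \<le> 2 * ?tb (Suc n) + 2 * integral (cbox 0 1) (\<lambda>x. (u x ?a - u x ?a)\<^sup>2
        + (\<Sum>k\<in>UNIV. (u1 k x ?a - u1 k x ?a)\<^sup>2) + (v x ?a - v x ?a)\<^sup>2)"
      by (rule energy_initial[simplified])
        (use C0_upto_slice[OF _ a] C0_fun dx(1)[OF a] u0 init True in auto)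
    then show ?thesis using True by simp
  next
    case False
    then have n: "1 \<le> n" "n \<in> {1..i}" "n \<le> l" using Suc.prems Sn by auto
    have le': "time_node T l n \<le> time_node T l i" "0 < time_node T l n"
      using T i n Suc.prems(2) by (auto intro: time_node_pos time_node_mono)
    obtain vt' u1' u2' U1' U2' Ut1' V1' Ut' Vt' where
      block': "block_error T l n (time_node T l n) (time_node T l (n - 1))
        f u v vt' u1' u2' U1' U2' Ut1' V1' U V Ut' Vt'"
      by (rule block_error_exists[where U = U and V = V, OF T n(1,3) sol C1_upto_mono[OF sol u v le'(2,1) le(2)]
        C0_upto_mono[OF v le'(1)] net(1)[OF n(2)] net(2)[OF n(2)] net(3)[OF n(2)] net(4)[OF n(2)]])
    interpret prev: block_error T l n "time_node T l n" "time_node T l (n - 1)"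
        f u v vt' u1' u2' U1' U2' Ut1' V1' U V Ut' Vt'
      by (rule block')
    have a': "?a \<in> {0..time_node T l n}" using prev.times by simp
    have u1_eq: "u1 k x ?a = u1' k x ?a" if "x \<in> cbox 0 1" for k x
      using partial_x_eq[OF dx(1)[OF a] that] partial_x_eq[OF prev.dx(1)[OF a'] that] by simp
    have "energy ?a \<le> 2 * ?tb (Suc n) + 2 * integral (cbox 0 1) (\<lambda>x. (U n x ?a - u x ?a)\<^sup>2
        + (\<Sum>k\<in>UNIV. (U1' k x ?a - u1 k x ?a)\<^sup>2) + (V n x ?a - v x ?a)\<^sup>2)"
      by (rule energy_initial[simplified])
        (use C0_upto_slice[OF _ a'] prev.C0_fun prev.dx(3) in auto)
    also have "integral (cbox 0 1) (\<lambda>x. (U n x ?a - u x ?a)\<^sup>2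
        + (\<Sum>k\<in>UNIV. (U1' k x ?a - u1 k x ?a)\<^sup>2) + (V n x ?a - v x ?a)\<^sup>2) = prev.energy ?a"
      unfolding prev.energy_def by (rule integral_cong) (simp add: u1_eq)
    also have "prev.energy ?a \<le> C_G T l f u v U V n * exp (2 * time_step T l)"
      unfolding prev.LINT_error[OF a', symmetric]
      by (rule Suc.IH) (use n Suc.prems prev.times in auto)
    finally show ?thesis by simp
  qed
  also have "?tb (Suc n) \<le> (\<Sum>j = 1..Suc n. ?tb j)"
    by (rule member_le_sum)
      (auto simp: set_lebesgue_integral_def intro!: Bochner_Integration.integral_nonneg)
  finally have a_le: "energy ?a \<le> 2 * (\<Sum>j = 1..Suc n. ?tb j)
      + 2 * C_G T l f u v U V n * exp (2 * time_step T l)" by simp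
  have \<tau>: "\<tau> \<in> {time_node T l (Suc n - 1)..time_node T l (Suc n)}" "\<tau> \<in> {0..time_node T l (Suc n)}"
    using Suc.prems(3) times by auto
  have "energy \<tau> \<le> exp (2 * time_step T l) * C_G T l f u v U V (Suc n)"
    by (rule order_trans[OF energy_le[OF \<tau>(1)]], rule mult_left_mono)
      (use a_le in \<open>simp_all add: C_tilde_def\<close>)
  then show ?case unfolding LINT_error[OF \<tau>(2)] by (simp add: mult.commute)
qed

theorem theorem5p2:
  fixes T :: real and l i :: nat
    and f u v uh vh :: "real ^ 'd \<Rightarrow> real \<Rightarrow> real"
    and \<psi>1 \<psi>2 :: "real ^ 'd \<Rightarrow> real"
    and \<theta>u \<theta>v :: "nat \<Rightarrow> hlconc_net"
    and U V :: "nat \<Rightarrow> real ^ 'd \<Rightarrow> real \<Rightarrow> real"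
  assumes "0 < T" and "1 \<le> i" and "i \<le> l"
    and "classical_wave_solution T f \<psi>1 \<psi>2 u v"
    and "C1_upto (time_node T l i) u" and "C0_upto (time_node T l i) v"
    and "\<And>j. j \<in> {1..i} \<Longrightarrow> hlconc_pinn (CARD('d) + 1) 1 (\<theta>u j)"
    and "\<And>j. j \<in> {1..i} \<Longrightarrow> hlconc_pinn (CARD('d) + 1) 1 (\<theta>v j)"
    and "\<And>j. j \<in> {1..i} \<Longrightarrow> U j = net_function (\<theta>u j)"
    and "\<And>j. j \<in> {1..i} \<Longrightarrow> V j = net_function (\<theta>v j)"
    and "\<And>x. x \<in> cell \<Longrightarrow> U 0 x (time_node T l 0) = \<psi>1 x"
    and "\<And>x. x \<in> cell \<Longrightarrow> V 0 x (time_node T l 0) = \<psi>2 x"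
    and "uh = (\<lambda>x t. U i x t - u x t)" and "vh = (\<lambda>x t. V i x t - v x t)"
  shows "(\<forall>\<tau>\<in>{time_node T l (i - 1)..time_node T l i}.
            (LINT x : cell | lborel.
               (uh x \<tau>)\<^sup>2 + (norm (grad (\<lambda>y. uh y \<tau>) x))\<^sup>2 + (vh x \<tau>)\<^sup>2)
            \<le> C_G T l f u v U V i * exp (2 * time_step T l)) \<and>
         (LINT t : {time_node T l (i - 1)..time_node T l i} | lborel.
            (LINT x : cell | lborel.
               (uh x t)\<^sup>2 + (norm (grad (\<lambda>y. uh y t) x))\<^sup>2 + (vh x t)\<^sup>2))
         \<le> C_G T l f u v U V i * time_step T l * exp (2 * time_step T l)"
proof -
  have bound: "(LINT x : cell | lborel. (U i x \<tau> - u x \<tau>)\<^sup>2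
      + (norm (grad (\<lambda>y. U i y \<tau> - u y \<tau>) x))\<^sup>2 + (V i x \<tau> - v x \<tau>)\<^sup>2)
    \<le> C_G T l f u v U V i * exp (2 * time_step T l)"
    if "\<tau> \<in> {time_node T l (i - 1)..time_node T l i}" for \<tau>
    by (rule energy_le_C_G[where \<theta>u = \<theta>u and \<theta>v = \<theta>v and ?\<psi>1.0 = \<psi>1 and ?\<psi>2.0 = \<psi>2
          and i = i and m = "CARD('d) + 1" and n = 1])
      (use assms that in auto)
  have ii: "i \<in> {1..i}" using assms(2) by simp
  obtain vt u1 u2 U1 U2 Ut1 V1 Ut Vt where
    block: "block_error T l i (time_node T l i) (time_node T l (i - 1))
      f u v vt u1 u2 U1 U2 Ut1 V1 U V Ut Vt"
    by (rule block_error_exists[where U = U and V = V, OF assms(1-6) assms(7)[OF ii] assms(8)[OF ii] assms(9)[OF ii] assms(10)[OF ii]])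
  interpret block_error T l i "time_node T l i" "time_node T l (i - 1)"
      f u v vt u1 u2 U1 U2 Ut1 V1 U V Ut Vt
    by (rule block)
  have "energy t \<le> C_G T l f u v U V i * exp (2 * time_step T l)"
    if "t \<in> {time_node T l (i - 1)..time_node T l i}" for t
  proof -
    have "t \<in> {0..time_node T l i}" using that times by auto
    from bound[OF that] show ?thesis unfolding LINT_error[OF \<open>t \<in> {0..time_node T l i}\<close>] .
  qed
  from LINT_time_error_le[OF this] bound show ?thesis
    unfolding assms(13,14) by (simp add: ac_simps)
qed

end
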